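(* The following statements hold for all sufficiently large $n$ (where the threshold may depend on the fixed $\ell$, respectively the fixed $F$ and $s$). (i) For every integer $\ell \ge 3$, $\mathrm{ex}_{\ell/(\ell-1)}(n,\{C_{4}, C_{6}, \ldots, C_{2\ell}\}) \le 765\, n^{\frac{\ell}{\ell-1}}$. (ii) $\mathrm{ex}_{3/2}(n,C_{6}) \le 2164\, n^{3/2}$. (iii) Suppose that $F$ is an $s$-bounded bipartite graph. Then $$\mathrm{ex}_{s}(n,F) \le 2 \left(\frac{|V(F)|^{s}}{s!} + |V(F)|\right) n^{s}.$$
   Context: All graphs are finite and simple; $C_k$ is the cycle of length $k$. For a graph $G$ and real $p\ge 0$, $\|G\|_p := \sum_{v\in V(G)} (d_G(v))^p$, where $d_G(v)$ is the degree of $v$. For a family $\mathcal{F}$ of graphs (or a single graph $F$, identified with the family $\{F\}$), $\mathrm{ex}_p(n,\mathcal{F})$ is the maximum of $\|G\|_p$ over all $n$-vertex graphs $G$ containing no member of $\mathcal{F}$ as a (not necessarily induced) subgraph. For a positive integer $s$, a bipartite graph $F$ with two parts $V_1$ and $V_2$ is $s$-bounded if every vertex in $V_2$ has degree at most $s$. *)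

theory Defs
  imports Complex_Main "HOL-Library.FuncSet"
begin

datatype 'a graph = Graph (verts: "'a set") (edges: "'a set set")

definition simple_graph :: "'a graph \<Rightarrow> bool" where
  "simple_graph G \<longleftrightarrow>
     finite (verts G) \<and> (\<forall>e\<in>edges G. e \<subseteq> verts G \<and> card e = 2)"

definition degree :: "'a graph \<Rightarrow> 'a \<Rightarrow> nat" where
  "degree G v = card {u \<in> verts G. {u, v} \<in> edges G}"

text \<open>Not-necessarily-induced subgraph containment: some subgraph of the second
  graph is isomorphic to the first.\<close>

definition contained_in :: "'a graph \<Rightarrow> 'b graph \<Rightarrow> bool" where
  "contained_in F G \<longleftrightarrow>
     (\<exists>f. inj_on f (verts F) \<and> f ` verts F \<subseteq> verts G \<and> (\<forall>e\<in>edges F. f ` e \<in> edges G))"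

text \<open>The degree power sum. Since \<open>0 powr 0 = 0\<close>, isolated vertices contribute
  nothing for \<open>p = 0\<close>; for \<open>p > 0\<close> there is no choice of convention.\<close>

definition degree_power_sum :: "real \<Rightarrow> 'a graph \<Rightarrow> real" where
  "degree_power_sum p G = (\<Sum>v\<in>verts G. real (degree G v) powr p)"

text \<open>Every finite graph is isomorphic to one with vertices in \<open>nat\<close>, so the host
  graphs are taken there. The set of values is finite (see below). It is empty only if
  some member of the family is edgeless with at most \<open>n\<close> vertices (so that every
  \<open>n\<close>-vertex graph contains it); the maximum is then \<open>0\<close> by convention.\<close>

definition free_values :: "real \<Rightarrow> nat \<Rightarrow> 'a graph set \<Rightarrow> real set" where
  "free_values p n \<F> =
     {degree_power_sum p G | G :: nat graph.
        simple_graph G \<and> card (verts G) = n \<and> (\<forall>F\<in>\<F>. \<not> contained_in F G)}"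

lemma finite_free_values: "finite (free_values p n \<F>)"
proof -
  let ?S = "\<lambda>c. \<Sum>d\<le>n. real (c d) * real d powr p"
  have "free_values p n \<F> \<subseteq> ?S ` ({..n} \<rightarrow>\<^sub>E {..n})"
  proof
    fix x assume "x \<in> free_values p n \<F>"
    then obtain G :: "nat graph" where G: "simple_graph G" "card (verts G) = n"
      and x: "x = degree_power_sum p G"
      by (auto simp: free_values_def)
    have fin: "finite (verts G)" using G by (simp add: simple_graph_def)
    have deg: "degree G v \<le> n" for v
      unfolding degree_def G(2)[symmetric] using fin by (intro card_mono) auto
    let ?c = "\<lambda>d. card {v \<in> verts G. degree G v = d}"
    have "x = (\<Sum>d\<le>n. \<Sum>v\<in>{v \<in> verts G. degree G v = d}. real (degree G v) powr p)"
      unfolding x degree_power_sum_def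
      using sum.group[OF fin, of "{..n}" "degree G" "\<lambda>v. real (degree G v) powr p"] deg
      by (simp add: image_subset_iff)
    also have "\<dots> = ?S (restrict ?c {..n})"
      by (intro sum.cong) auto
    finally have "x = ?S (restrict ?c {..n})" .
    moreover have "?c d \<le> n" for d
      unfolding G(2)[symmetric] using fin by (intro card_mono) auto
    then have "restrict ?c {..n} \<in> {..n} \<rightarrow>\<^sub>E {..n}"
      by auto
    ultimately show "x \<in> ?S ` ({..n} \<rightarrow>\<^sub>E {..n})"
      by (rule image_eqI)
  qed
  then show ?thesis
    by (rule finite_subset) (intro finite_imageI finite_PiE; simp)
qed

definition ex :: "real \<Rightarrow> nat \<Rightarrow> 'a graph set \<Rightarrow> real" where
  "ex p n \<F> = (if free_values p n \<F> = {} then 0 else Max (free_values p n \<F>))"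

text \<open>A genuine cycle only for \<open>k \<ge> 3\<close>.\<close>

definition cycle_graph :: "nat \<Rightarrow> nat graph" where
  "cycle_graph k = Graph {..<k} {{i, Suc i mod k} | i. i < k}"

definition bounded_bipartite :: "nat \<Rightarrow> 'a graph \<Rightarrow> bool" where
  "bounded_bipartite s F \<longleftrightarrow> simple_graph F \<and>
     (\<exists>V1 V2. V1 \<union> V2 = verts F \<and> V1 \<inter> V2 = {} \<and>
        (\<forall>e\<in>edges F. \<exists>x\<in>V1. \<exists>y\<in>V2. e = {x, y}) \<and>
        (\<forall>v\<in>V2. degree F v \<le> s))"

end

theory Submission
  imports Defs
begin

text \<open>
  All three bounds say that a graph without certain bipartite subgraphs has few vertices of large
  degree. Two mechanisms are used.

  \<^bold>\<open>Even cycles.\<close> A maximum cut keeps at least half of every degree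
  (\<open>exists_large_cut\<close>), so at the cost of a factor \<open>2 powr p\<close> the graph is bipartite.
  For a set \<open>U\<close> of \<open>m\<close> vertices in one part of a bipartite graph inside an \<open>n\<close>-vertex set, let
  \<open>e\<close> be the number of edges at \<open>U\<close>. If \<open>e\<close> is large, one finds a subgraph in
  which the degrees are at least \<open>e / (3 m)\<close> on the side of \<open>U\<close> and at least \<open>e / (3 n)\<close> on the
  other side. Breadth-first search from a vertex of \<open>U\<close> in this subgraph multiplies the size of the
  levels alternately by constant multiples of these two degrees. Without the even cycles
  \<open>C\<^sub>4, \<dots>, C\<^sub>2\<^sub>l\<close> this holds because every vertex of the first \<open>l\<close> levels below the root has just one
  parent (\<open>level_growth\<close>); without \<open>C\<^sub>6\<close> alone the same growth holds for three
  levels because the graphs between consecutive levels are sparse (\<open>level_3_large\<close>). The last level has at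
  most \<open>n\<close> vertices, and at most \<open>m\<close> if it is on the side of \<open>U\<close>; this gives
  \<open>e \<le> c * max ((m * n) powr ((l + 1) / (2 * l))) n\<close> with an absolute constant \<open>c\<close>.

  This estimate for all \<open>U\<close> controls degree powers (\<open>power_sum_le\<close>). If the maximum is \<open>n\<close>, then
  \<open>U\<close> meets at most \<open>c * n\<close> edges, so it contributes at most \<open>c * n * n powr (p - 1)\<close>.
  Otherwise some vertex of \<open>U\<close> has degree at most \<open>c * (m * n) powr ((l + 1) / (2 * l)) / m\<close>, and
  for \<open>p = l / (l - 1)\<close> the \<open>p\<close>-th power of this number is proportional to \<open>1 / sqrt m\<close>.
  Peeling off such vertices one after the other therefore costs a factor
  \<open>\<Sum>m\<le>n. 1 / sqrt m \<le> 2 * sqrt n\<close>, and there is no logarithmic loss.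

  \<^bold>\<open>Bounded bipartite graphs.\<close> Let \<open>V1\<close>, \<open>V2\<close> be the parts and suppose \<open>2 \<le> s \<le> card V1\<close>.
  If the neighbourhood of a vertex \<open>v\<close> contains an injective image of \<open>V1\<close> such that the \<open>i\<close>-th
  vertex of \<open>V2\<close> still has more than \<open>card V1 + i\<close> common neighbours to choose from, then \<open>F\<close> can be
  embedded greedily. So in an \<open>F\<close>-free graph, if \<open>v\<close> has large degree, at least half of the maps from
  \<open>V1\<close> to its neighbourhood contain, for some \<open>i\<close>, an \<open>s\<close>-tuple with at most \<open>card V1 + i\<close> common neighbours.
  Summed over \<open>v\<close>, there are at most \<open>(card V1 + i) * n ^ s\<close> such tuples, and
  \<open>2 * (\<Sum>i<card V2. card V1 + i)\<close> is at most \<open>h ^ 2\<close> for \<open>h = card V1 + card V2\<close>, which is at most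
  \<open>2 * h ^ s / s!\<close> (\<open>sum_degree_power_le\<close>). If \<open>card V1 < s\<close>, the same count is applied to
  \<open>s\<close>-tuples with at most \<open>h\<close> common neighbours. For \<open>s = 1\<close> the graph \<open>F\<close> is a forest of stars,
  and fewer than \<open>card V1\<close> vertices can have degree at least \<open>h\<close>.
\<close>

section \<open>Graphs as symmetric relations\<close>

definition arcs :: "'a graph \<Rightarrow> ('a \<times> 'a) set" where
  "arcs G = {(u, v). u \<in> verts G \<and> v \<in> verts G \<and> {u, v} \<in> edges G}"

lemma arcs_subset: "arcs G \<subseteq> verts G \<times> verts G"
  by (auto simp: arcs_def)

lemma sym_arcs: "sym (arcs G)"
  by (auto simp: arcs_def sym_def insert_commute)

lemma irrefl_arcs: "simple_graph G \<Longrightarrow> (v, v) \<notin> arcs G"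
  by (auto simp: arcs_def simple_graph_def)

lemma finite_arcs: "simple_graph G \<Longrightarrow> finite (arcs G)"
  by (rule finite_subset[OF arcs_subset]) (simp add: simple_graph_def)

lemma degree_eq_card_arcs: "v \<in> verts G \<Longrightarrow> degree G v = card (arcs G `` {v})"
  unfolding degree_def by (rule arg_cong[of _ _ card]) (auto simp: arcs_def insert_commute)

lemma ex_le:
  assumes "0 \<le> K"
    and "\<And>G :: nat graph. \<lbrakk>simple_graph G; card (verts G) = n; \<forall>F\<in>\<F>. \<not> contained_in F G\<rbrakk>
      \<Longrightarrow> degree_power_sum p G \<le> K"
  shows "ex p n \<F> \<le> K"
proof (cases "free_values p n \<F> = {}")
  case True
  then show ?thesis using assms(1) by (simp add: ex_def)
next
  case False
  have "x \<le> K" if "x \<in> free_values p n \<F>" for x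
    using that assms(2) by (auto simp: free_values_def)
  then show ?thesis
    using False Max_in[OF finite_free_values False] by (simp add: ex_def)
qed

definition has_cycle :: "('a \<times> 'a) set \<Rightarrow> nat \<Rightarrow> bool" where
  "has_cycle E k \<longleftrightarrow> (\<exists>xs. length xs = k \<and> distinct xs \<and>
     successively (\<lambda>u v. (u, v) \<in> E) xs \<and> (last xs, hd xs) \<in> E)"

lemma has_cycle_mono: "has_cycle E k \<Longrightarrow> E \<subseteq> E' \<Longrightarrow> has_cycle E' k"
  unfolding has_cycle_def by (blast intro: successively_mono)

lemma cycle_graph_contained_in:
  assumes "has_cycle (arcs G) k" "k \<ge> 1"
  shows "contained_in (cycle_graph k) G"
proof -
  obtain xs where len: "length xs = k" and dist: "distinct xs"
    and succ: "successively (\<lambda>u v. (u, v) \<in> arcs G) xs" and close: "(last xs, hd xs) \<in> arcs G"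
    using assms(1) by (auto simp: has_cycle_def)
  have ne: "xs \<noteq> []" using len assms(2) by auto
  have step: "(xs ! i, xs ! (Suc i mod k)) \<in> arcs G" if "i < k" for i
  proof (cases "Suc i < k")
    case True
    then show ?thesis using succ len by (auto simp: successively_conv_nth)
  next
    case False
    then have "Suc i = k" using that by simp
    then show ?thesis using close ne len by (simp add: last_conv_nth hd_conv_nth flip: \<open>Suc i = k\<close>)
  qed
  show ?thesis
    unfolding contained_in_def
  proof (intro exI[of _ "nth xs"] conjI ballI)
    show "inj_on ((!) xs) (verts (cycle_graph k))"
      using dist len by (auto simp: cycle_graph_def inj_on_nth)
    show "(!) xs ` verts (cycle_graph k) \<subseteq> verts G"
      using step by (auto simp: cycle_graph_def arcs_def)
    show "(!) xs ` e \<in> edges G" if "e \<in> edges (cycle_graph k)" for e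
      using that step by (auto simp: cycle_graph_def arcs_def)
  qed
qed

section \<open>Dense cores and large cuts\<close>

lemma card_Int_Times:
  assumes "finite A" "finite B"
  shows "card (E \<inter> A \<times> B) = (\<Sum>a\<in>A. card (E `` {a} \<inter> B))"
proof -
  have "E \<inter> A \<times> B = (SIGMA a:A. E `` {a} \<inter> B)" by auto
  then show ?thesis using assms by simp
qed

lemma sum_neighbours_swap:
  assumes "sym E" "finite A" "finite B"
  shows "(\<Sum>a\<in>A. card (E `` {a} \<inter> B)) = (\<Sum>b\<in>B. card (E `` {b} \<inter> A))"
proof -
  have "bij_betw prod.swap (E \<inter> A \<times> B) (E \<inter> B \<times> A)"
    using assms(1) by (auto intro!: bij_betw_byWitness[where f' = prod.swap] dest: symD)
  then have "card (E \<inter> A \<times> B) = card (E \<inter> B \<times> A)" by (rule bij_betw_same_card)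
  then show ?thesis using assms by (simp add: card_Int_Times)
qed

text \<open>Delete vertices of too small degree. Such a deletion increases the potential
  "edges minus \<open>\<alpha>\<close> times left vertices minus \<open>\<beta>\<close> times right vertices", so a pair of subsets
  maximising the potential has the required minimum degrees. It is nonempty because the potential of
  the whole graph is positive.\<close>

lemma exists_dense_core:
  fixes \<alpha> \<beta> :: real
  assumes "sym E" "finite A" "finite B" "0 \<le> \<alpha>" "0 \<le> \<beta>"
    and dense: "\<alpha> * card A + \<beta> * card B < (\<Sum>a\<in>A. card (E `` {a} \<inter> B))"
  obtains A' B' where "A' \<subseteq> A" "B' \<subseteq> B" "A' \<noteq> {}"
    "\<And>a. a \<in> A' \<Longrightarrow> \<alpha> \<le> card (E `` {a} \<inter> B')"
    "\<And>b. b \<in> B' \<Longrightarrow> \<beta> \<le> card (E `` {b} \<inter> A')"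
proof -
  define ed where "ed P Q = (\<Sum>a\<in>P. card (E `` {a} \<inter> Q))" for P Q
  define f where "f z = real (ed (fst z) (snd z)) - \<alpha> * card (fst z) - \<beta> * card (snd z)" for z
  let ?D = "Pow A \<times> Pow B"
  have D: "finite (f ` ?D)" "f ` ?D \<noteq> {}" using assms by auto
  from Max_in[OF D] obtain z where fz: "Max (f ` ?D) = f z" and z: "z \<in> ?D" by (rule imageE)
  have max: "f y \<le> f z" if "y \<in> ?D" for y
    unfolding fz[symmetric] using D(1) that by (intro Max_ge imageI)
  obtain A' B' where zz: "z = (A', B')" by (cases z)
  have sub: "A' \<subseteq> A" "B' \<subseteq> B" using z zz by auto
  have fin: "finite A'" "finite B'"
    using finite_subset[OF sub(1) assms(2)] finite_subset[OF sub(2) assms(3)] by auto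
  have swap: "ed P Q = ed Q P" if "finite P" "finite Q" for P Q
    unfolding ed_def using that by (rule sum_neighbours_swap[OF assms(1)])
  have pos: "0 < f z"
    using max[of "(A, B)"] dense by (simp add: f_def ed_def)
  have ne: "A' \<noteq> {}"
    using pos mult_nonneg_nonneg[OF assms(5), of "card B'"] by (auto simp: zz f_def ed_def)
  have 1: "\<alpha> \<le> card (E `` {a} \<inter> B')" if a: "a \<in> A'" for a
  proof -
    have "ed A' B' = card (E `` {a} \<inter> B') + ed (A' - {a}) B'"
      unfolding ed_def using a fin by (simp add: sum.remove)
    moreover have "real (card A') = card (A' - {a}) + 1"
      using a fin card_Suc_Diff1 by fastforce
    moreover have "f (A' - {a}, B') \<le> f (A', B')" using max[of "(A' - {a}, B')"] zz sub by auto
    ultimately show ?thesis by (simp add: f_def algebra_simps)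
  qed
  have 2: "\<beta> \<le> card (E `` {b} \<inter> A')" if b: "b \<in> B'" for b
  proof -
    have "ed B' A' = card (E `` {b} \<inter> A') + ed (B' - {b}) A'"
      unfolding ed_def using b fin by (simp add: sum.remove)
    then have "ed A' B' = card (E `` {b} \<inter> A') + ed A' (B' - {b})"
      using swap[OF fin] swap[of A' "B' - {b}"] fin by simp
    moreover have "real (card B') = card (B' - {b}) + 1"
      using b fin card_Suc_Diff1 by fastforce
    moreover have "f (A', B' - {b}) \<le> f (A', B')" using max[of "(A', B' - {b})"] zz sub by auto
    ultimately show ?thesis by (simp add: f_def algebra_simps)
  qed
  from sub ne 1 2 show ?thesis by (rule that)
qed

text \<open>In a cut with the largest number of crossing arcs, moving a single vertex to
  the other side does not gain anything; hence at least half of its neighbours are on the other side.\<close>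

lemma exists_large_cut:
  assumes "finite E" "sym E" "\<And>v. (v, v) \<notin> E"
  obtains S where "\<And>v. card (E `` {v}) \<le> 2 * card {u \<in> E `` {v}. u \<in> S \<longleftrightarrow> v \<notin> S}"
proof -
  define cut where "cut S = {e \<in> E. fst e \<in> S \<longleftrightarrow> snd e \<notin> S}" for S
  have fin: "finite (cut S)" for S using assms(1) by (simp add: cut_def)
  have "finite (range (\<lambda>S. card (cut S)))"
    by (rule finite_subset[of _ "{..card E}"])
      (auto simp: cut_def intro!: card_mono assms(1))
  then have "Max (range (\<lambda>S. card (cut S))) \<in> range (\<lambda>S. card (cut S))" by (intro Max_in) auto
  then obtain S where S: "card (cut S) = Max (range (\<lambda>S. card (cut S)))" by (metis imageE)
  have max: "card (cut T) \<le> card (cut S)" for T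
    unfolding S using \<open>finite (range _)\<close> by (intro Max_ge) auto
  have "card (E `` {v}) \<le> 2 * card {u \<in> E `` {v}. u \<in> S \<longleftrightarrow> v \<notin> S}" for v
  proof -
    define P where "P = {u \<in> E `` {v}. u \<in> S \<longleftrightarrow> v \<notin> S}"
    define Q where "Q = {u \<in> E `` {v}. u \<in> S \<longleftrightarrow> v \<in> S}"
    define T where "T = (if v \<in> S then S - {v} else insert v S)"
    define R where "R = {e \<in> cut S. fst e \<noteq> v \<and> snd e \<noteq> v}"
    have finN: "finite (E `` {v})" using assms(1) by (simp add: finite_Image)
    have "P \<subseteq> E `` {v}" "Q \<subseteq> E `` {v}" "R \<subseteq> cut S" by (auto simp: P_def Q_def R_def)
    then have fins: "finite P" "finite Q" "finite R" using finN fin finite_subset by blast+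
    have nv: "v \<notin> P" "v \<notin> Q" using assms(3) by (auto simp: P_def Q_def)
    have inT: "w \<in> T \<longleftrightarrow> (if w = v then v \<notin> S else w \<in> S)" for w by (auto simp: T_def)
    have "cut S = R \<union> ({v} \<times> P \<union> P \<times> {v})"
      using assms(2,3) by (auto simp: cut_def R_def P_def dest: symD)
    moreover have "card (R \<union> ({v} \<times> P \<union> P \<times> {v})) = card R + card ({v} \<times> P \<union> P \<times> {v})"
      using fins by (intro card_Un_disjoint) (auto simp: R_def)
    ultimately have "card (cut S) = card R + card ({v} \<times> P \<union> P \<times> {v})" by simp
    also have "card ({v} \<times> P \<union> P \<times> {v}) = 2 * card P"
      using fins nv by (subst card_Un_disjoint) (auto simp: card_cartesian_product)
    finally have 1: "card (cut S) = card R + 2 * card P" .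
    have "cut T = R \<union> ({v} \<times> Q \<union> Q \<times> {v})"
      using assms(2,3) by (auto simp: cut_def R_def Q_def inT split: if_splits dest: symD)
    moreover have "card (R \<union> ({v} \<times> Q \<union> Q \<times> {v})) = card R + card ({v} \<times> Q \<union> Q \<times> {v})"
      using fins by (intro card_Un_disjoint) (auto simp: R_def)
    ultimately have "card (cut T) = card R + card ({v} \<times> Q \<union> Q \<times> {v})" by simp
    also have "card ({v} \<times> Q \<union> Q \<times> {v}) = 2 * card Q"
      using fins nv by (subst card_Un_disjoint) (auto simp: card_cartesian_product)
    finally have 2: "card (cut T) = card R + 2 * card Q" .
    have "E `` {v} = P \<union> Q" "P \<inter> Q = {}" by (auto simp: P_def Q_def)
    then have "card (E `` {v}) = card P + card Q" using fins by (simp add: card_Un_disjoint)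
    then show ?thesis using 1 2 max[of T] by (simp add: P_def)
  qed
  then show ?thesis by (rule that)
qed

section \<open>Breadth-first levels in bipartite graphs\<close>

text \<open>Only the membership in one part \<open>X\<close> is recorded; the other part is its
  complement. Swapping the parts then means replacing \<open>X\<close> by \<open>- X\<close>.\<close>

locale bipartite =
  fixes E :: "('a \<times> 'a) set" and X :: "'a set"
  assumes fin: "finite E" and sym: "sym E"
    and bip: "(u, v) \<in> E \<Longrightarrow> u \<in> X \<longleftrightarrow> v \<notin> X"
begin

definition level :: "'a \<Rightarrow> nat \<Rightarrow> 'a set" where
  "level r k = {v. (r, v) \<in> E ^^ k \<and> (\<forall>j<k. (r, v) \<notin> E ^^ j)}"

lemma level_0 [simp]: "level r 0 = {r}"
  by (auto simp: level_def)

lemma level_inj: "v \<in> level r i \<Longrightarrow> v \<in> level r j \<Longrightarrow> i = j"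
  unfolding level_def by (metis (mono_tags, lifting) linorder_neqE_nat mem_Collect_eq)

lemma level_neq: "u \<in> level r i \<Longrightarrow> v \<in> level r j \<Longrightarrow> i \<noteq> j \<Longrightarrow> u \<noteq> v"
  using level_inj by blast

lemma level_SucE:
  assumes "v \<in> level r (Suc k)"
  obtains u where "u \<in> level r k" "(u, v) \<in> E"
proof -
  obtain u where u: "(r, u) \<in> E ^^ k" "(u, v) \<in> E"
    using assms by (auto simp: level_def)
  have "(r, u) \<notin> E ^^ j" if "j < k" for j
    using assms u(2) that by (force simp: level_def)
  then show ?thesis using u that by (auto simp: level_def)
qed

lemma level_parity: "v \<in> level r k \<Longrightarrow> v \<in> X \<longleftrightarrow> (r \<in> X \<longleftrightarrow> even k)"
proof (induction k arbitrary: v)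
  case (Suc k)
  then obtain u where "u \<in> level r k" "(u, v) \<in> E" by (blast elim: level_SucE)
  then show ?case using Suc.IH bip by auto
qed auto

text \<open>Along an edge the distance to the root changes by at most one, and by parity it
  cannot stay the same in a bipartite graph.\<close>

lemma level_step:
  assumes u: "u \<in> level r k" and uv: "(u, v) \<in> E"
  shows "v \<in> level r (Suc k) \<or> (\<exists>j. k = Suc j \<and> v \<in> level r j)"
proof -
  have "(r, v) \<in> E ^^ Suc k" using assms by (auto simp: level_def)
  define j where "j = (LEAST j. (r, v) \<in> E ^^ j)"
  have j: "(r, v) \<in> E ^^ j" and "j \<le> Suc k"
    unfolding j_def by (rule LeastI Least_le, fact)+
  have vj: "v \<in> level r j" using j not_less_Least by (auto simp: level_def j_def)
  have "(r, u) \<in> E ^^ Suc j" using j uv sym by (auto dest: symD)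
  then have "k \<le> Suc j" using u by (force simp: level_def not_less[symmetric])
  moreover have "j \<noteq> k" using level_parity[OF u] level_parity[OF vj] bip[OF uv] by auto
  ultimately have "j = Suc k \<or> k = Suc j" using \<open>j \<le> Suc k\<close> by auto
  then show ?thesis using vj by auto
qed

lemma level_subset: "level r (Suc k) \<subseteq> snd ` E"
  by (force elim: level_SucE)

lemma finite_level [simp]: "finite (level r k)"
  by (cases k) (auto intro: finite_subset[OF level_subset] fin)

lemma finite_nbrs [simp]: "finite (E `` S)"
  by (rule finite_subset[of _ "snd ` E"]) (force simp: fin)+

lemma nbrs_level_Suc:
  "u \<in> level r (Suc k) \<Longrightarrow>
     card (E `` {u}) = card (E `` {u} \<inter> level r k) + card (E `` {u} \<inter> level r (Suc (Suc k)))"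
proof -
  assume u: "u \<in> level r (Suc k)"
  have eq: "(E `` {u} \<inter> level r k) \<union> (E `` {u} \<inter> level r (Suc (Suc k))) = E `` {u}"
    using level_step[OF u] by auto
  have "w \<notin> level r (Suc (Suc k))" if "w \<in> level r k" for w
    using level_inj[OF that, of "Suc (Suc k)"] by auto
  then have "(E `` {u} \<inter> level r k) \<inter> (E `` {u} \<inter> level r (Suc (Suc k))) = {}" by auto
  from card_Un_disjoint[OF _ _ this] show ?thesis unfolding eq by simp
qed

lemma nbrs_level_0: "E `` {r} \<inter> level r 1 = E `` {r}"
  using level_step[of r r 0] by auto

text \<open>Climb from both vertices towards the root until the two ancestor lines meet for the
  first time.\<close>

lemma level_path:
  assumes "u \<in> level r i" "u' \<in> level r i" "u \<noteq> u'"
  shows "\<exists>j xs. 1 \<le> j \<and> j \<le> i \<and> length xs = Suc (2 * j) \<and> distinct xs \<and> hd xs = u \<and> last xs = u' \<and>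
    successively (\<lambda>a b. (a, b) \<in> E) xs \<and> set xs \<subseteq> (\<Union>k\<le>i. level r k)"
  using assms
proof (induction i arbitrary: u u')
  case (Suc i)
  obtain x where x: "x \<in> level r i" "(x, u) \<in> E" using Suc.prems(1) by (rule level_SucE)
  obtain x' where x': "x' \<in> level r i" "(x', u') \<in> E" using Suc.prems(2) by (rule level_SucE)
  have rev: "(u, x) \<in> E" "(u', x') \<in> E" using x x' sym by (auto dest: symD)
  show ?case
  proof (cases "x = x'")
    case True
    have neq: "x \<noteq> u" "x \<noteq> u'" using level_neq[OF x(1)] Suc.prems by auto
    have "u \<in> (\<Union>k\<le>Suc i. level r k)" "u' \<in> (\<Union>k\<le>Suc i. level r k)" "x \<in> (\<Union>k\<le>Suc i. level r k)"
      using Suc.prems x(1) by (blast intro: le_SucI)+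
    then have "set [u, x, u'] \<subseteq> (\<Union>k\<le>Suc i. level r k)" by simp
    moreover have "distinct [u, x, u']" using neq Suc.prems by auto
    moreover have "successively (\<lambda>a b. (a, b) \<in> E) [u, x, u']" using rev x' True by simp
    ultimately show ?thesis
      by (intro exI[of _ 1] exI[of _ "[u, x, u']"]) simp
  next
    case False
    from Suc.IH[OF x(1) x'(1) False] obtain j xs where xs: "1 \<le> j" "j \<le> i" "length xs = Suc (2 * j)"
      "distinct xs" "hd xs = x" "last xs = x'" "successively (\<lambda>a b. (a, b) \<in> E) xs"
      "set xs \<subseteq> (\<Union>k\<le>i. level r k)" by blast
    have ne: "xs \<noteq> []" using xs(3) by auto
    have new: "w \<notin> set xs" if "w \<in> level r (Suc i)" for w
      
    proof
      assume "w \<in> set xs"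
      then obtain k where "k \<le> i" "w \<in> level r k" using xs(8) by blast
      then show False using level_inj[OF that, of k] by simp
    qed
    show ?thesis
    proof (intro exI[of _ "Suc j"] exI[of _ "u # xs @ [u']"] conjI)
      show "successively (\<lambda>a b. (a, b) \<in> E) (u # xs @ [u'])"
        using xs ne rev x' by (auto simp: successively_Cons successively_append_iff)
      show "set (u # xs @ [u']) \<subseteq> (\<Union>k\<le>Suc i. level r k)"
      proof -
        have eq: "(\<Union>k\<le>Suc i. level r k) = level r (Suc i) \<union> (\<Union>k\<le>i. level r k)"
          by (simp add: atMost_Suc)
        show ?thesis unfolding eq using xs(8) Suc.prems(1,2) by (simp add: le_supI2)
      qed
      show "1 \<le> Suc j" "Suc j \<le> Suc i" "length (u # xs @ [u']) = Suc (2 * Suc j)"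
        using xs by auto
      show "distinct (u # xs @ [u'])"
        using xs(4) new[OF Suc.prems(1)] new[OF Suc.prems(2)] Suc.prems(3) by simp
      show "hd (u # xs @ [u']) = u" "last (u # xs @ [u']) = u'" by simp_all
    qed
  qed
qed simp

text \<open>A vertex with two parents closes the path between the parents through
  their lowest common ancestor to an even cycle.\<close>

lemma cycle_of_two_parents:
  assumes w: "w \<in> level r (Suc i)" and u: "u \<in> level r i" "(u, w) \<in> E"
    and u': "u' \<in> level r i" "(u', w) \<in> E" and ne: "u \<noteq> u'"
  shows "\<exists>k. 2 \<le> k \<and> k \<le> Suc i \<and> has_cycle E (2 * k)"
proof -
  obtain j xs where xs: "1 \<le> j" "j \<le> i" "length xs = Suc (2 * j)"
      "distinct xs" "hd xs = u" "last xs = u'" "successively (\<lambda>a b. (a, b) \<in> E) xs"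
      "set xs \<subseteq> (\<Union>k\<le>i. level r k)"
    using level_path[OF u(1) u'(1) ne] by blast
  have "xs \<noteq> []" using xs(3) by auto
  moreover have "w \<notin> set xs" 
    proof
      assume "w \<in> set xs"
      then obtain k where "k \<le> i" "w \<in> level r k" using xs(8) by blast
      then show False using level_inj[OF w, of k] by simp
    qed
  moreover have "(w, u) \<in> E" using u(2) sym by (auto dest: symD)
  ultimately have "has_cycle E (2 * Suc j)"
    unfolding has_cycle_def
    using xs u' by (intro exI[of _ "w # xs"]) (auto simp: successively_Cons)
  then show ?thesis using xs(1,2) by (intro exI[of _ "Suc j"]) auto
qed

text \<open>The degree conditions are imposed only on vertices reachable from the root \<open>r\<close>, the even
  levels being those on the side of the root.\<close>

definition min_degrees :: "'a \<Rightarrow> real \<Rightarrow> real \<Rightarrow> bool" where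
  "min_degrees r \<alpha> \<beta> \<longleftrightarrow> r \<in> X \<and>
     (\<forall>k. \<forall>v\<in>level r k. (if even k then \<alpha> else \<beta>) \<le> card (E `` {v}))"

text \<open>A vertex has at most one neighbour in the previous level, so all others are in the next
  level; and as vertices of the next level have a unique parent, these sets of children are disjoint.\<close>

lemma level_growth:
  assumes deg: "min_degrees r \<alpha> \<beta>" and \<alpha>: "1 \<le> \<alpha>" and \<beta>: "1 \<le> \<beta>"
    and free: "\<And>k. 2 \<le> k \<Longrightarrow> k \<le> l \<Longrightarrow> \<not> has_cycle E (2 * k)" and "k \<le> l"
  shows "(\<alpha> - 1) ^ ((k + 1) div 2) * (\<beta> - 1) ^ (k div 2) \<le> card (level r k)"
  using \<open>k \<le> l\<close>
proof (induction k)
  case (Suc k)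
  define \<delta> where "\<delta> = (if even k then \<alpha> else \<beta>)"
  have \<delta>: "\<delta> \<ge> 1" using \<alpha> \<beta> by (simp add: \<delta>_def)
  have unique: "u = u'" if "w \<in> level r (Suc i)" "u \<in> level r i" "(u, w) \<in> E" "u' \<in> level r i" "(u', w) \<in> E"
    "i \<le> k" for u u' w i
    using cycle_of_two_parents[OF that(1-5)] free that(6) Suc.prems by (meson Suc_le_mono le_trans)
  have up: "\<delta> - 1 \<le> card (E `` {u} \<inter> level r (Suc k))" if u: "u \<in> level r k" for u
  proof -
    have d: "\<delta> \<le> card (E `` {u})" using deg u by (auto simp: min_degrees_def \<delta>_def)
    show ?thesis
    proof (cases k)
      case 0
      then show ?thesis using d u nbrs_level_0[of r] by auto
    next
      case (Suc i)
      have "card (E `` {u} \<inter> level r i) \<le> 1"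
        using unique[of u i] u Suc sym by (auto simp: card_le_Suc0_iff_eq dest: symD)
      then show ?thesis using d nbrs_level_Suc[of u r i] u Suc by simp
    qed
  qed
  have "(\<delta> - 1) * card (level r k) \<le> (\<Sum>u\<in>level r k. real (card (E `` {u} \<inter> level r (Suc k))))"
    using sum_mono[of "level r k" "\<lambda>_. \<delta> - 1"] up by (simp add: mult.commute)
  also have "\<dots> = card (\<Union>u\<in>level r k. E `` {u} \<inter> level r (Suc k))"
    using unique[of _ k] by (subst card_UN_disjoint) auto
  also have "\<dots> \<le> card (level r (Suc k))" by (intro of_nat_mono card_mono) auto
  finally have "(\<delta> - 1) * ((\<alpha> - 1) ^ ((k + 1) div 2) * (\<beta> - 1) ^ (k div 2)) \<le> card (level r (Suc k))"
    using Suc mult_left_mono[of _ "real (card (level r k))" "\<delta> - 1"] \<delta> by fastforce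
  then show ?case by (cases "even k") (auto simp: \<delta>_def elim!: evenE oddE simp: ac_simps)
qed simp

text \<open>Vertices of \<open>B\<close> with at most two neighbours account for
  \<open>2 * card B\<close> edges. The neighbourhoods of the others are disjoint subsets of \<open>A\<close>.\<close>

lemma edges_le_if_no_shared_neighbour:
  assumes "finite A" "finite B"
    and "\<And>a b b'. \<lbrakk>a \<in> A; b \<in> B; b' \<in> B; b \<noteq> b'; (b, a) \<in> E; (b', a) \<in> E;
      3 \<le> card (E `` {b} \<inter> A); 3 \<le> card (E `` {b'} \<inter> A)\<rbrakk> \<Longrightarrow> False"
  shows "(\<Sum>b\<in>B. card (E `` {b} \<inter> A)) \<le> card A + 2 * card B"
proof -
  define B3 where "B3 = {b \<in> B. 3 \<le> card (E `` {b} \<inter> A)}"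
  have "B3 \<subseteq> B" by (auto simp: B3_def)
  then have "(\<Sum>b\<in>B. card (E `` {b} \<inter> A)) =
      (\<Sum>b\<in>B - B3. card (E `` {b} \<inter> A)) + (\<Sum>b\<in>B3. card (E `` {b} \<inter> A))"
    using assms by (simp add: sum.subset_diff)
  also have "(\<Sum>b\<in>B - B3. card (E `` {b} \<inter> A)) \<le> (\<Sum>b\<in>B - B3. 2)"
    by (intro sum_mono) (auto simp: B3_def)
  also have "\<dots> \<le> 2 * card B" using assms by (simp add: card_mono)
  also have "(\<Sum>b\<in>B3. card (E `` {b} \<inter> A)) = card (\<Union>b\<in>B3. E `` {b} \<inter> A)"
    using assms by (subst card_UN_disjoint) (auto simp: B3_def)
  also have "\<dots> \<le> card A" using assms by (intro card_mono) auto
  finally show ?thesis by simp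
qed

lemma obtain_third_neighbour:
  assumes "3 \<le> card S"
  obtains c where "c \<in> S" "c \<noteq> a" "c \<noteq> b"
proof -
  have "\<not> S \<subseteq> {a, b}"
  proof
    assume "S \<subseteq> {a, b}"
    then have "card S \<le> card {a, b}" by (intro card_mono) auto
    also have "\<dots> \<le> 2" by (simp add: card_insert_if)
    finally show False using assms by simp
  qed
  then show ?thesis using that by blast
qed

lemma has_cycle_6I:
  assumes "distinct [a, b, c, d, e, f]"
    "(a, b) \<in> E" "(b, c) \<in> E" "(c, d) \<in> E" "(d, e) \<in> E" "(e, f) \<in> E" "(f, a) \<in> E"
  shows "has_cycle E 6"
  unfolding has_cycle_def using assms by (intro exI[of _ "[a, b, c, d, e, f]"]) simp

text \<open>Two vertices \<open>b\<close>, \<open>b'\<close> at distance two with three neighbours each and a common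
  neighbour \<open>a\<close> give a path \<open>a'' b a b' a'\<close>, which the root closes to a hexagon.\<close>

lemma level_1_2_edges:
  assumes free: "\<not> has_cycle E 6"
  shows "(\<Sum>b\<in>level r 2. card (E `` {b} \<inter> level r 1)) \<le> card (level r 1) + 2 * card (level r 2)"
proof (rule edges_le_if_no_shared_neighbour)
  fix a b b'
  assume h: "a \<in> level r 1" "b \<in> level r 2" "b' \<in> level r 2" "b \<noteq> b'" "(b, a) \<in> E" "(b', a) \<in> E"
    "3 \<le> card (E `` {b} \<inter> level r 1)" "3 \<le> card (E `` {b'} \<inter> level r 1)"
  obtain a' where a': "a' \<in> E `` {b'} \<inter> level r 1" "a' \<noteq> a" using obtain_third_neighbour[OF h(8)] by metis
  obtain a'' where a'': "a'' \<in> E `` {b} \<inter> level r 1" "a'' \<noteq> a" "a'' \<noteq> a'"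
    using obtain_third_neighbour[OF h(7)] by metis
  have root: "(r, x) \<in> E" if "x \<in> level r 1" for x
    using that level_SucE[of x r 0] by auto
  have disj: "r \<notin> level r (Suc 0)" "r \<notin> level r 2" "\<And>x. x \<in> level r (Suc 0) \<Longrightarrow> x \<notin> level r 2"
    using level_inj[of _ r 0] level_inj[of _ r "Suc 0" 2] by fastforce+
  have "has_cycle E 6"
  proof (rule has_cycle_6I)
    show "distinct [r, a'', b, a, b', a']"
      using h a' a'' disj by auto
  qed (use h a' a'' root sym in \<open>auto dest: symD\<close>)
  then show False using free by simp
qed auto

text \<open>Let \<open>z\<close> be in the third level and let \<open>y\<close>, \<open>w\<close> be two of its parents. If \<open>x\<close>
  is a parent of \<open>y\<close> and \<open>x2 \<noteq> x\<close> is a parent of \<open>w\<close>, then \<open>r x y z w x2\<close> is a hexagon. So all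
  parents of \<open>z\<close>, if there are at least two, are children of the same vertex \<open>x\<close>, and \<open>x\<close> takes over the part
  of the root in the argument for the first two levels.\<close>

lemma level_2_3_edges:
  assumes free: "\<not> has_cycle E 6"
  shows "(\<Sum>b\<in>level r 3. card (E `` {b} \<inter> level r 2)) \<le> card (level r 2) + 2 * card (level r 3)"
proof (rule edges_le_if_no_shared_neighbour)
  fix y z z'
  assume h: "y \<in> level r 2" "z \<in> level r 3" "z' \<in> level r 3" "z \<noteq> z'" "(z, y) \<in> E" "(z', y) \<in> E"
    "3 \<le> card (E `` {z} \<inter> level r 2)" "3 \<le> card (E `` {z'} \<inter> level r 2)"
  have parent: "\<exists>x. x \<in> level r 1 \<and> (x, w) \<in> E" if "w \<in> level r 2" for w
    using that level_SucE[of w r 1] by (auto simp: numeral_2_eq_2)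
  obtain x where x: "x \<in> level r 1" "(x, y) \<in> E" using parent[OF h(1)] by blast
  have root: "(r, x) \<in> E" if "x \<in> level r 1" for x
    using that level_SucE[of x r 0] by auto
  have disj: "r \<notin> level r (Suc 0)" "r \<notin> level r 2" "r \<notin> level r 3"
    "\<And>x. x \<in> level r (Suc 0) \<Longrightarrow> x \<notin> level r 2 \<and> x \<notin> level r 3"
    "\<And>x. x \<in> level r 2 \<Longrightarrow> x \<notin> level r 3"
    using level_inj[of _ r 0] level_inj[of _ r "Suc 0"] level_inj[of _ r 2 3] by fastforce+
  have same: "(x, w) \<in> E" if w: "w \<in> level r 2" "(z0, w) \<in> E" and z0: "z0 \<in> level r 3" "(z0, y) \<in> E" for w z0
  proof (rule ccontr)
    assume n: "(x, w) \<notin> E"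
    obtain x2 where x2: "x2 \<in> level r 1" "(x2, w) \<in> E" using parent[OF w(1)] by blast
    have "has_cycle E 6"
    proof (rule has_cycle_6I)
      have "x \<noteq> x2" "y \<noteq> w" using n x x2 by auto
      then show "distinct [r, x, y, z0, w, x2]"
        using disj x(1) h(1) z0(1) w(1) x2(1) by auto
    qed (use x x2 w z0 root sym in \<open>auto dest: symD\<close>)
    then show False using free by simp
  qed
  obtain y' where y': "y' \<in> E `` {z'} \<inter> level r 2" "y' \<noteq> y" using obtain_third_neighbour[OF h(8)] by metis
  obtain y'' where y'': "y'' \<in> E `` {z} \<inter> level r 2" "y'' \<noteq> y" "y'' \<noteq> y'"
    using obtain_third_neighbour[OF h(7)] by metis
  have "has_cycle E 6"
  proof (rule has_cycle_6I)
    show "distinct [x, y'', z, y, z', y']"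
      using disj x(1) h y' y'' by auto
    show "(x, y'') \<in> E" using same[of y'' z] h y'' by auto
    show "(y', x) \<in> E" using same[of y' z'] h y' sym by (auto dest: symD)
  qed (use h y' y'' sym in \<open>auto dest: symD\<close>)
  then show False using free by simp
qed auto

text \<open>Up to lower-order terms, the edges leaving a level are at most twice as many as the
  vertices of the next level, so each of the two later steps multiplies the size by about half the
  minimum degree. The bound 8 on the degrees absorbs the lower-order terms into the constant
  \<open>3 / 32\<close>, the product of \<open>3 / 8\<close> for the second level and \<open>1 / 4\<close> for the third.\<close>

lemma level_3_large:
  assumes deg: "min_degrees r \<alpha> \<beta>" and \<alpha>: "8 \<le> \<alpha>" and \<beta>: "8 \<le> \<beta>"
    and free: "\<not> has_cycle E 6"
  shows "3 / 32 * (\<alpha> ^ 2 * \<beta>) \<le> card (level r 3)"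
proof -
  define n1 n2 n3 where "n1 = real (card (level r 1))" and "n2 = real (card (level r 2))"
    and "n3 = real (card (level r 3))"
  define e12 where "e12 = (\<Sum>b\<in>level r 2. card (E `` {b} \<inter> level r 1))"
  define e23 where "e23 = (\<Sum>b\<in>level r 3. card (E `` {b} \<inter> level r 2))"
  have d: "(if even k then \<alpha> else \<beta>) \<le> card (E `` {v})" if "v \<in> level r k" for v k
    using deg that by (auto simp: min_degrees_def)
  have n: "0 \<le> n1" "0 \<le> n2" "0 \<le> n3" by (simp_all add: n1_def n2_def n3_def)
  have "E `` {r} \<subseteq> level r 1" using nbrs_level_0[of r] by auto
  then have "card (E `` {r}) \<le> card (level r 1)" by (intro card_mono) auto
  then have 1: "\<alpha> \<le> n1" using d[of r 0] by (simp add: n1_def)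
  have "(\<beta> - 1) * n1 \<le> (\<Sum>v\<in>level r 1. real (card (E `` {v} \<inter> level r 2)))"
  proof -
    have "\<beta> - 1 \<le> card (E `` {v} \<inter> level r 2)" if v: "v \<in> level r 1" for v
    proof -
      have "card (E `` {v} \<inter> level r 0) \<le> card {r}" by (intro card_mono) auto
      then show ?thesis
        using nbrs_level_Suc[of v r 0] d[OF v] v by (simp add: numeral_2_eq_2)
    qed
    then show ?thesis
      using sum_mono[of "level r 1" "\<lambda>_. \<beta> - 1"] by (simp add: n1_def mult.commute)
  qed
  also have "\<dots> = e12"
    unfolding e12_def using sum_neighbours_swap[OF sym, of "level r 1" "level r 2"] by (simp flip: of_nat_sum)
  finally have "(\<beta> - 1) * n1 \<le> e12" .
  moreover have e12: "real e12 \<le> n1 + 2 * n2"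
    using of_nat_mono[OF level_1_2_edges[OF free, of r], where ?'a = real]
    by (simp add: e12_def n1_def n2_def del: of_nat_sum)
  ultimately have 2: "(\<beta> - 2) * n1 \<le> 2 * n2" by (simp add: algebra_simps)
  have "\<alpha> * n2 \<le> (\<Sum>v\<in>level r 2. real (card (E `` {v})))"
    using sum_mono[of "level r 2" "\<lambda>_. \<alpha>"] d[of _ 2] by (simp add: n2_def mult.commute)
  also have "\<dots> = real (\<Sum>v\<in>level r 2. card (E `` {v} \<inter> level r 1) + card (E `` {v} \<inter> level r 3))"
    using nbrs_level_Suc[of _ r 1] by (simp add: numeral_2_eq_2 numeral_3_eq_3)
  also have "\<dots> = e12 + e23"
    unfolding e12_def e23_def sum.distrib using sum_neighbours_swap[OF sym, of "level r 2" "level r 3"] by simp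
  finally have "\<alpha> * n2 \<le> real e12 + real e23" by simp
  moreover have "real e23 \<le> n2 + 2 * n3"
    using of_nat_mono[OF level_2_3_edges[OF free, of r], where ?'a = real]
    by (simp add: e23_def n2_def n3_def del: of_nat_sum)
  ultimately have 3: "(\<alpha> - 3) * n2 \<le> n1 + 2 * n3" using e12 by (simp add: algebra_simps)
  have "3 / 4 * \<beta> * n1 \<le> (\<beta> - 2) * n1" using \<beta> n by (intro mult_right_mono) auto
  then have n2: "3 / 8 * \<beta> * n1 \<le> n2" using 2 by simp
  have "n1 * 2 \<le> n1 * (\<beta> - 2)" using \<beta> n by (intro mult_left_mono) auto
  then have "n1 \<le> n2" using 2 by (simp add: mult.commute)
  then have "(\<alpha> - 4) * n2 \<le> 2 * n3" using 3 by (simp add: algebra_simps)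
  moreover have "\<alpha> / 2 * n2 \<le> (\<alpha> - 4) * n2" using \<alpha> n by (intro mult_right_mono) auto
  ultimately have "\<alpha> / 4 * n2 \<le> n3" by simp
  moreover have "\<alpha> / 4 * (3 / 8 * \<beta> * \<alpha>) \<le> \<alpha> / 4 * n2"
  proof (rule mult_left_mono)
    have "3 / 8 * \<beta> * \<alpha> \<le> 3 / 8 * \<beta> * n1" using 1 \<beta> by (intro mult_left_mono) auto
    also note n2
    finally show "3 / 8 * \<beta> * \<alpha> \<le> n2" .
  qed (use \<alpha> in simp)
  ultimately show ?thesis by (simp add: n3_def power2_eq_square algebra_simps)
qed

end

section \<open>From edge bounds to degree powers\<close>

text \<open>Remove elements with \<open>f u \<le> g (card U)\<close> from the current set \<open>U\<close>
  until the sum over the remaining set is at most \<open>K\<close>.\<close>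

lemma sum_le_by_peeling:
  fixes f :: "'a \<Rightarrow> real"
  assumes "finite A" and g: "\<And>m. 0 \<le> g m"
    and peel: "\<And>U. U \<subseteq> A \<Longrightarrow> U \<noteq> {} \<Longrightarrow> sum f U \<le> K \<or> (\<exists>u\<in>U. f u \<le> g (card U))"
    and K: "0 \<le> K"
  shows "sum f A \<le> K + (\<Sum>m=1..card A. g m)"
  using assms(1) peel
proof (induction "card A" arbitrary: A)
  case 0
  then show ?case using K by simp
next
  case (Suc n)
  have ne: "A \<noteq> {}" using Suc.hyps(2) by auto
  have g_sum: "0 \<le> (\<Sum>m=1..card A. g m)" using g by (simp add: sum_nonneg)
  from Suc.prems(2)[OF order_refl ne] show ?case
  proof
    assume "sum f A \<le> K"
    then show ?thesis using g_sum by simp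
  next
    assume "\<exists>u\<in>A. f u \<le> g (card A)"
    then obtain u where u: "u \<in> A" "f u \<le> g (card A)" by blast
    have card: "n = card (A - {u})" using Suc.hyps(2) Suc.prems(1) u(1) by simp
    have "sum f (A - {u}) \<le> K + (\<Sum>m=1..n. g m)"
      unfolding card
    proof (rule Suc.hyps(1)[OF card])
      show "sum f U \<le> K \<or> (\<exists>u\<in>U. f u \<le> g (card U))" if "U \<subseteq> A - {u}" "U \<noteq> {}" for U
        using that Suc.prems(2)[of U] by blast
    qed (use Suc.prems(1) in simp)
    moreover have "sum f A = f u + sum f (A - {u})" using Suc.prems(1) u(1) by (rule sum.remove)
    ultimately show ?thesis using u(2) by (simp flip: Suc.hyps(2))
  qed
qed

lemma sum_inverse_sqrt_le: "(\<Sum>m=1..n. 1 / sqrt (real m)) \<le> 2 * sqrt (real n)"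
proof (induction n)
  case (Suc n)
  have "1 / sqrt (real (Suc n)) \<le> 2 * (sqrt (real (Suc n)) - sqrt (real n))"
  proof -
    let ?a = "sqrt (real (Suc n))" and ?b = "sqrt (real n)"
    have "?a > 0" "?b \<ge> 0" "?b \<le> ?a" by auto
    moreover have "(?a - ?b) * (?a + ?b) = 1" by (simp add: algebra_simps)
    moreover from this have "(?a - ?b) * (?a + ?b) \<le> (?a - ?b) * (2 * ?a)"
      by (intro mult_left_mono) auto
    ultimately have "1 \<le> (?a - ?b) * (2 * ?a)" by linarith
    then have "1 \<le> 2 * (?a - ?b) * ?a" by (simp only: mult_ac)
    then show ?thesis using \<open>?a > 0\<close> by (simp only: pos_divide_le_eq)
  qed
  then show ?case using Suc by simp
qed simp

text \<open>The exponents are tied together so that the \<open>p\<close>-th power of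
  \<open>(m * N) powr q / m\<close> is \<open>N powr (p - 1 / 2) / sqrt m\<close>: sets \<open>U\<close> for which the first term
  of the maximum dominates can be peeled with this cost, and those for which \<open>N\<close> dominates satisfy
  \<open>sum d U \<le> C * N\<close> and are estimated by their largest possible degree \<open>N\<close>.\<close>

lemma power_sum_le:
  fixes d :: "'a \<Rightarrow> real" and N t C :: real
  defines "p \<equiv> t / (t - 1)" and "q \<equiv> (t + 1) / (2 * t)"
  assumes t: "1 < t" and C: "0 \<le> C" and "finite A" and N: "card A \<le> N"
    and d: "\<And>a. a \<in> A \<Longrightarrow> 0 \<le> d a" "\<And>a. a \<in> A \<Longrightarrow> d a \<le> N"
    and sparse: "\<And>U. U \<subseteq> A \<Longrightarrow> U \<noteq> {} \<Longrightarrow> sum d U \<le> C * max ((card U * N) powr q) N"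
  shows "(\<Sum>a\<in>A. d a powr p) \<le> (C + 2 * C powr p) * N powr p"
proof -
  have N0: "0 \<le> N" using N by linarith
  have p: "1 < p" using t by (simp add: p_def)
  define g where "g m = C powr p * N powr (p - 1 / 2) * (1 / sqrt (real m))" for m :: nat
  have "(\<Sum>a\<in>A. d a powr p) \<le> C * N powr p + (\<Sum>m=1..card A. g m)"
  proof (rule sum_le_by_peeling)
    fix U assume U: "U \<subseteq> A" "U \<noteq> {}"
    have fin: "finite U" using U assms(5) finite_subset by auto
    have m: "0 < card U" using U fin by (simp add: card_gt_0_iff)
    then have Npos: "0 < N" using N card_mono[OF assms(5) U(1)] by linarith
    show "(\<Sum>a\<in>U. d a powr p) \<le> C * N powr p \<or> (\<exists>u\<in>U. d u powr p \<le> g (card U))"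
    proof (cases "(card U * N) powr q \<le> N")
      case True
      then have s: "sum d U \<le> C * N" using sparse[OF U] by simp
      have "d a powr p \<le> d a * N powr (p - 1)" if "a \<in> U" for a
      proof -
        have a: "0 \<le> d a" "d a \<le> N" using d U that by auto
        have "d a powr p = d a * d a powr (p - 1)"
          using powr_mult_base[OF a(1), of "p - 1"] by simp
        also have "\<dots> \<le> d a * N powr (p - 1)"
          using a p by (intro mult_left_mono powr_mono2) auto
        finally show ?thesis .
      qed
      then have "(\<Sum>a\<in>U. d a powr p) \<le> sum d U * N powr (p - 1)"
        using sum_mono[of U "\<lambda>a. d a powr p" "\<lambda>a. d a * N powr (p - 1)"] by (simp add: sum_distrib_right)
      also have "\<dots> \<le> C * N * N powr (p - 1)" using s by (intro mult_right_mono) auto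
      also have "\<dots> = C * N powr p" using powr_mult_base[OF N0, of "p - 1"] by simp
      finally show ?thesis by simp
    next
      case False
      define c where "c = C * (card U * N) powr q / card U"
      have s: "sum d U \<le> C * (card U * N) powr q" using sparse[OF U] False by simp
      have "\<exists>u\<in>U. d u \<le> c"
      proof (rule ccontr)
        assume "\<not> (\<exists>u\<in>U. d u \<le> c)"
        then have "sum (\<lambda>_. c) U < sum d U" using fin U by (intro sum_strict_mono) auto
        moreover have "sum (\<lambda>_. c) U = C * (card U * N) powr q" using m by (simp add: c_def)
        ultimately show False using s by simp
      qed
      then obtain u where u: "u \<in> U" "d u \<le> c" by blast
      have e1: "q * p = p - 1 / 2" using t by (simp add: p_def q_def field_simps)
      have e2: "p - 1 / 2 - p = - (1 / 2)" by simp
      have "d u powr p \<le> c powr p" using u d U p by (intro powr_mono2) auto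
      also have "c powr p = C powr p * ((card U * N) powr q) powr p / card U powr p"
        using C N0 unfolding c_def by (simp add: powr_divide powr_mult)
      also have "\<dots> = C powr p * N powr (p - 1 / 2) * (card U powr (p - 1 / 2) / card U powr p)"
        using N0 by (simp add: powr_powr e1 powr_mult)
      also have "card U powr (p - 1 / 2) / card U powr p = 1 / sqrt (real (card U))"
        unfolding powr_diff[symmetric] e2 powr_minus_divide by (simp add: powr_half_sqrt)
      finally show ?thesis using u(1) by (auto simp: g_def)
    qed
  qed (use assms(5) C in \<open>auto simp: g_def\<close>)
  also have "(\<Sum>m=1..card A. g m) = C powr p * N powr (p - 1 / 2) * (\<Sum>m=1..card A. 1 / sqrt (real m))"
    by (simp add: g_def sum_distrib_left)
  also have "\<dots> \<le> C powr p * N powr (p - 1 / 2) * (2 * sqrt N)"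
  proof (rule mult_left_mono)
    have "sqrt (real (card A)) \<le> sqrt N" using N by simp
    then show "(\<Sum>m=1..card A. 1 / sqrt (real m)) \<le> 2 * sqrt N"
      using sum_inverse_sqrt_le[of "card A"] by linarith
  qed simp
  also have "\<dots> = 2 * C powr p * N powr p"
  proof -
    have "N powr (p - 1 / 2) * sqrt N = N powr (p - 1 / 2 + 1 / 2)"
      unfolding powr_add powr_half_sqrt[OF N0] ..
    then have *: "N powr (p - 1 / 2) * sqrt N = N powr p" by simp
    have "C powr p * N powr (p - 1 / 2) * (2 * sqrt N) = 2 * C powr p * (N powr (p - 1 / 2) * sqrt N)"
      by simp
    then show ?thesis unfolding * .
  qed
  finally show ?thesis by (simp add: algebra_simps)
qed

section \<open>Graphs without short even cycles\<close>

lemma power_of_powr_eq: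
  fixes x y :: real
  assumes "0 < x" "y * real n = real k"
  shows "(x powr y) ^ n = x ^ k"
proof -
  have "(x powr y) ^ n = (x powr y) powr real n" using assms(1) by (simp add: powr_realpow)
  also have "\<dots> = x powr real k" by (simp only: powr_powr assms(2))
  finally show ?thesis using assms(1) by (simp add: powr_realpow)
qed

text \<open>The two thresholds together account for at most two thirds of the \<open>e\<close> edges, so
  the core is nonempty.\<close>

lemma bipartite_core:
  fixes H :: "('a \<times> 'a) set"
  assumes H: "bipartite H X" "H \<subseteq> V \<times> V" and V: "finite V" and U: "U \<subseteq> X \<inter> V" "U \<noteq> {}"
  defines "e \<equiv> real (\<Sum>u\<in>U. card (H `` {u}))"
  assumes "0 < e"
  obtains H' r where "bipartite H' X" "H' \<subseteq> H"
    "bipartite.min_degrees H' X r (e / (3 * real (card U))) (e / (3 * real (card V)))"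
    "\<And>k. bipartite.level H' r k \<subseteq> (if even k then U else V)"
proof -
  interpret H: bipartite H X by (rule H(1))
  define B where "B = V - X"
  have fin: "finite U" "finite B" using U V finite_subset by (auto simp: B_def)
  have B: "H `` {u} \<inter> B = H `` {u}" if "u \<in> U" for u
    using that U(1) H(2) H.bip by (auto simp: B_def)
  have pos: "0 < card U" using U(2) fin by (simp add: card_gt_0_iff)
  have "card U \<le> card V" using U V by (intro card_mono) auto
  then have posV: "0 < card V" using pos by simp
  have dense: "e / (3 * real (card U)) * card U + e / (3 * real (card V)) * card B < (\<Sum>u\<in>U. card (H `` {u} \<inter> B))"
  proof -
    have "e / (3 * real (card V)) * card B \<le> e / (3 * real (card V)) * card V"
      using \<open>0 < e\<close> V by (intro mult_left_mono of_nat_mono card_mono) (auto simp: B_def)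
    then have "e / (3 * real (card U)) * card U + e / (3 * real (card V)) * card B \<le> e / 3 + e / 3"
      using pos posV by simp
    also have "\<dots> < e" using \<open>0 < e\<close> by simp
    also have "e = (\<Sum>u\<in>U. card (H `` {u} \<inter> B))" using B by (simp add: e_def)
    finally show ?thesis .
  qed
  obtain U' B' where core: "U' \<subseteq> U" "B' \<subseteq> B" "U' \<noteq> {}"
    "\<And>a. a \<in> U' \<Longrightarrow> e / (3 * real (card U)) \<le> card (H `` {a} \<inter> B')"
    "\<And>b. b \<in> B' \<Longrightarrow> e / (3 * real (card V)) \<le> card (H `` {b} \<inter> U')"
    using exists_dense_core[OF H.sym fin _ _ dense] \<open>0 < e\<close> by auto
  define H' where "H' = H \<inter> (U' \<times> B' \<union> B' \<times> U')"
  have sub: "H' \<subseteq> H" by (auto simp: H'_def)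
  have bip: "bipartite H' X"
    by unfold_locales (use sub H.fin H.sym H.bip finite_subset in \<open>auto simp: H'_def sym_def\<close>)
  interpret H': bipartite H' X by (rule bip)
  obtain r where r: "r \<in> U'" using core(3) by blast
  have disj: "U' \<inter> B' = {}" using core U by (auto simp: B_def)
  have lev: "v \<in> (if even k then U' else B')" if "v \<in> H'.level r k" for v k
    using that
  proof (induction k arbitrary: v)
    case 0
    then show ?case using r by simp
  next
    case (Suc k)
    then obtain u where "u \<in> H'.level r k" "(u, v) \<in> H'" by (blast elim: H'.level_SucE)
    then show ?case using Suc.IH[of u] disj by (auto simp: H'_def split: if_splits)
  qed
  have deg: "H' `` {v} = (if v \<in> U' then H `` {v} \<inter> B' else H `` {v} \<inter> U')" if "v \<in> U' \<union> B'" for v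
    using disj that by (auto simp: H'_def)
  have "H'.min_degrees r (e / (3 * real (card U))) (e / (3 * real (card V)))"
    unfolding H'.min_degrees_def
  proof (intro conjI allI ballI)
    show "r \<in> X" using r core U by auto
    fix k v assume "v \<in> H'.level r k"
    from lev[OF this] show "(if even k then e / (3 * real (card U)) else e / (3 * real (card V))) \<le> card (H' `` {v})"
      using core(4)[of v] core(5)[of v] deg[of v] disj by (auto split: if_splits)
  qed
  moreover have "H'.level r k \<subseteq> (if even k then U else V)" for k
  proof -
    have "H'.level r k \<subseteq> (if even k then U' else B')" using lev by blast
    also have "\<dots> \<subseteq> (if even k then U else V)" using core(1,2) by (auto simp: B_def)
    finally show ?thesis .
  qed
  ultimately show ?thesis using bip sub that by blast
qed

text \<open>In a counterexample both minimum degrees of the core are at least 4, so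
  subtracting the parent leaves at least three quarters of them, that is, \<open>e / (4 m)\<close> and \<open>e / (4 N)\<close>.
  Then level \<open>l\<close> has at least as many vertices as the product of \<open>l\<close> such factors, alternating between
  the two, but at most \<open>m\<close> or \<open>N\<close> according to the parity of \<open>l\<close>. In both cases the square of this
  inequality gives \<open>(e / 4) ^ (2 l) \<le> (m N) ^ (l + 1)\<close>, using \<open>m \<le> N\<close> for even \<open>l\<close>.\<close>

lemma sum_card_neighbours_le_girth:
  fixes H :: "('a \<times> 'a) set" and l :: nat
  assumes H: "bipartite H X" "H \<subseteq> V \<times> V" and V: "finite V" and U: "U \<subseteq> X \<inter> V" "U \<noteq> {}"
    and l: "1 \<le> l" and free: "\<And>k. 2 \<le> k \<Longrightarrow> k \<le> l \<Longrightarrow> \<not> has_cycle H (2 * k)"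
  shows "real (\<Sum>u\<in>U. card (H `` {u})) \<le>
    12 * max ((real (card U) * card V) powr ((real l + 1) / (2 * real l))) (card V)"
proof (rule ccontr)
  define e m N where "e = real (\<Sum>u\<in>U. card (H `` {u}))" and "m = real (card U)" and "N = real (card V)"
  assume "\<not> ?thesis"
  then have big: "12 * (m * N) powr ((real l + 1) / (2 * real l)) < e" "12 * N < e"
    by (auto simp: e_def m_def N_def not_le)
  have "finite U" using U V finite_subset by auto
  then have m: "0 < m" using U(2) by (simp add: m_def card_gt_0_iff)
  have mN: "m \<le> N" unfolding m_def N_def using U V by (intro of_nat_mono card_mono) auto
  have e: "0 < e" using big(2) m mN by linarith
  obtain H' r where H': "bipartite H' X" "H' \<subseteq> H"
    "bipartite.min_degrees H' X r (e / (3 * m)) (e / (3 * N))"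
    "\<And>k. bipartite.level H' r k \<subseteq> (if even k then U else V)"
    by (rule bipartite_core[OF H V U e[unfolded e_def], folded e_def m_def N_def]) (rule that)
  interpret H': bipartite H' X by (rule H'(1))
  have \<alpha>: "4 \<le> e / (3 * m)" using big(2) m mN by (simp add: field_simps)
  have \<beta>: "4 \<le> e / (3 * N)" using big(2) m mN by (simp add: field_simps)
  have free': "\<not> has_cycle H' (2 * k)" if "2 \<le> k" "k \<le> l" for k
    using free[OF that] has_cycle_mono[OF _ H'(2)] by blast
  define a b where "a = e / (4 * m)" and "b = e / (4 * N)"
  have a: "0 \<le> a" "a \<le> e / (3 * m) - 1" using \<alpha> m e by (auto simp: a_def field_simps)
  have b: "0 \<le> b" "b \<le> e / (3 * N) - 1" using \<beta> m mN e by (auto simp: b_def field_simps)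
  define M where "M = (if even l then m else N)"
  have "a ^ ((l + 1) div 2) * b ^ (l div 2)
      \<le> (e / (3 * m) - 1) ^ ((l + 1) div 2) * (e / (3 * N) - 1) ^ (l div 2)"
    using a b by (intro mult_mono power_mono) auto
  also have "\<dots> \<le> card (H'.level r l)"
    using H'.level_growth[OF H'(3) _ _ free'] \<alpha> \<beta> by simp
  also have "\<dots> \<le> M"
    using card_mono[OF _ H'(4)[of l]] V \<open>finite U\<close>
    by (cases "even l") (simp_all add: M_def m_def N_def)
  finally have grow: "(a ^ ((l + 1) div 2) * b ^ (l div 2))\<^sup>2 \<le> M\<^sup>2"
    using a b by (intro power_mono) auto
  define x z where "x = e / 4" and "z = m * N"
  have z: "0 < z" using m mN by (simp add: z_def)
  have "x ^ (2 * l) \<le> z ^ (l + 1)"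
  proof (cases "even l")
    case True
    then obtain k where k: "l = 2 * k" by (elim evenE)
    note grow
    moreover have "(a ^ ((l + 1) div 2) * b ^ (l div 2))\<^sup>2 = (a * b) ^ (2 * k)"
      by (simp add: k power_mult_distrib mult.commute flip: power_mult)
    ultimately have "(a * b) ^ (2 * k) \<le> m * m"
      using True by (simp add: M_def power2_eq_square)
    also have "\<dots> \<le> m * N" using m mN by simp
    finally have "(a * b) ^ (2 * k) \<le> m * N" .
    moreover have "a * b = x\<^sup>2 / z"
      by (simp add: a_def b_def x_def z_def power2_eq_square)
    moreover have "(x\<^sup>2 / z) ^ (2 * k) = x ^ (2 * l) / z ^ (2 * k)"
      by (simp add: k power_divide flip: power_mult)
    ultimately have "x ^ (2 * l) \<le> z * z ^ (2 * k)"
      using z by (simp add: pos_divide_le_eq z_def)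
    then show ?thesis by (simp add: k)
  next
    case False
    then obtain k where k: "l = 2 * k + 1" by (elim oddE)
    note grow
    moreover have "(a ^ ((l + 1) div 2) * b ^ (l div 2))\<^sup>2 = ((a * b) ^ k * a)\<^sup>2"
      by (simp add: k power_mult_distrib mult.commute)
    moreover have "\<dots> = (a * b) ^ (2 * k) * a\<^sup>2"
      by (simp only: power_mult_distrib[of _ a 2] power_mult[symmetric] mult.commute[of k 2])
    ultimately have "(a * b) ^ (2 * k) * a\<^sup>2 \<le> N\<^sup>2"
      using False by (simp add: M_def)
    moreover have "a * b = x\<^sup>2 / z"
      by (simp add: a_def b_def x_def z_def power2_eq_square)
    moreover have "a = x / m" by (simp add: a_def x_def)
    moreover have "(x\<^sup>2 / z) ^ (2 * k) * (x / m)\<^sup>2 = x ^ (2 * l) / (z ^ (2 * k) * m\<^sup>2)"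
      by (simp add: k power_divide power_add flip: power_mult, simp add: power2_eq_square)
    ultimately have "x ^ (2 * l) \<le> N\<^sup>2 * (z ^ (2 * k) * m\<^sup>2)"
      using z m by (simp add: pos_divide_le_eq)
    also have "\<dots> = z ^ (2 * k) * z\<^sup>2" by (simp add: z_def power_mult_distrib)
    also have "\<dots> = z ^ (l + 1)" by (simp add: k flip: power_add)
    finally show ?thesis .
  qed
  then have "e ^ (2 * l) \<le> 4 ^ (2 * l) * (m * N) ^ (l + 1)"
    by (simp add: x_def z_def power_divide pos_divide_le_eq mult.commute)
  moreover have "12 ^ (2 * l) * (m * N) ^ (l + 1) < e ^ (2 * l)"
  proof -
    have pos: "0 < m * N" using m mN by simp
    have "((m * N) powr ((real l + 1) / (2 * real l))) ^ (2 * l) = (m * N) ^ (l + 1)"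
      using l by (intro power_of_powr_eq[OF pos]) simp
    moreover have "(12 * (m * N) powr ((real l + 1) / (2 * real l))) ^ (2 * l) < e ^ (2 * l)"
      using big(1) l by (intro power_strict_mono) auto
    ultimately show ?thesis by (simp add: power_mult_distrib)
  qed
  moreover have "4 ^ (2 * l) * (m * N) ^ (l + 1) \<le> 12 ^ (2 * l) * (m * N) ^ (l + 1)"
    using m mN by (intro mult_right_mono power_mono) auto
  ultimately show False by linarith
qed

text \<open>The third level of the core is large but has at most \<open>N\<close> vertices,
  which gives \<open>e ^ 3 \<le> 288 * (m N) ^ 2\<close>. The constant 24 ensures that the degrees in the core are at
  least 8.\<close>

lemma sum_card_neighbours_le_C6:
  fixes H :: "('a \<times> 'a) set"
  assumes H: "bipartite H X" "H \<subseteq> V \<times> V" and V: "finite V" and U: "U \<subseteq> X \<inter> V" "U \<noteq> {}"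
    and free: "\<not> has_cycle H 6"
  shows "real (\<Sum>u\<in>U. card (H `` {u})) \<le> 24 * max ((real (card U) * card V) powr (2 / 3)) (card V)"
proof (rule ccontr)
  define e m N where "e = real (\<Sum>u\<in>U. card (H `` {u}))" and "m = real (card U)" and "N = real (card V)"
  assume "\<not> ?thesis"
  then have big: "24 * (m * N) powr (2 / 3) < e" "24 * N < e"
    by (auto simp: e_def m_def N_def not_le)
  have "finite U" using U V finite_subset by auto
  then have m: "0 < m" using U(2) by (simp add: m_def card_gt_0_iff)
  have mN: "m \<le> N" unfolding m_def N_def using U V by (intro of_nat_mono card_mono) auto
  have e: "0 < e" using big(2) m mN by linarith
  obtain H' r where H': "bipartite H' X" "H' \<subseteq> H"
    "bipartite.min_degrees H' X r (e / (3 * m)) (e / (3 * N))"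
    "\<And>k. bipartite.level H' r k \<subseteq> (if even k then U else V)"
    by (rule bipartite_core[OF H V U e[unfolded e_def], folded e_def m_def N_def]) (rule that)
  interpret H': bipartite H' X by (rule H'(1))
  have \<alpha>: "8 \<le> e / (3 * m)" using big(2) m mN by (simp add: field_simps)
  have \<beta>: "8 \<le> e / (3 * N)" using big(2) m mN by (simp add: field_simps)
  have free': "\<not> has_cycle H' 6"
    using free has_cycle_mono[OF _ H'(2)] by blast
  have "3 / 32 * ((e / (3 * m))\<^sup>2 * (e / (3 * N))) \<le> card (H'.level r 3)"
    using H'.level_3_large[OF H'(3) \<alpha> \<beta> free'] .
  also have "\<dots> \<le> N" using card_mono[OF V, of "H'.level r 3"] H'(4)[of 3] by (simp add: N_def)
  finally have "3 / 32 * ((e / (3 * m))\<^sup>2 * (e / (3 * N))) \<le> N" .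
  then have up: "e ^ 3 \<le> 288 * (m * N)\<^sup>2"
    using m mN by (simp add: field_simps power2_eq_square power3_eq_cube)
  have pos: "0 < m * N" using m mN by simp
  have "((m * N) powr (2 / 3)) ^ 3 = (m * N)\<^sup>2"
    by (rule power_of_powr_eq[OF pos]) simp
  then have "(24 * (m * N) powr (2 / 3)) ^ 3 = 24 ^ 3 * (m * N)\<^sup>2" by (simp add: power_mult_distrib)
  moreover have "(24 * (m * N) powr (2 / 3)) ^ 3 < e ^ 3"
    using big(1) by (intro power_strict_mono) auto
  moreover have "0 < (m * N)\<^sup>2" using pos by (rule zero_less_power)
  ultimately show False using up by simp
qed

text \<open>Pass to a large cut and add up the estimates for its two sides.\<close>

lemma degree_power_sum_le_of_bipartite:
  fixes G :: "'a graph" and t C :: real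
  defines "p \<equiv> t / (t - 1)"
  assumes G: "simple_graph G" and t: "1 < t" and C: "0 \<le> C"
    and sparse: "\<And>H X U. \<lbrakk>bipartite H X; H \<subseteq> arcs G; U \<subseteq> X \<inter> verts G; U \<noteq> {}\<rbrakk> \<Longrightarrow>
      real (\<Sum>u\<in>U. card (H `` {u})) \<le>
        C * max ((real (card U) * card (verts G)) powr ((t + 1) / (2 * t))) (card (verts G))"
  shows "degree_power_sum p G \<le> 2 powr p * (2 * (C + 2 * C powr p)) * card (verts G) powr p"
proof -
  define V N where "V = verts G" and "N = real (card V)"
  have V: "finite V" using G by (simp add: V_def simple_graph_def)
  have p: "1 < p" using t by (simp add: p_def)
  obtain S where S: "\<And>v. card (arcs G `` {v}) \<le> 2 * card {u \<in> arcs G `` {v}. u \<in> S \<longleftrightarrow> v \<notin> S}"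
    using exists_large_cut[OF finite_arcs[OF G] sym_arcs irrefl_arcs[OF G]] by blast
  define H where "H = {(u, v) \<in> arcs G. u \<in> S \<longleftrightarrow> v \<notin> S}"
  have sub: "H \<subseteq> arcs G" by (auto simp: H_def)
  have bip: "bipartite H S" "bipartite H (- S)"
    by (unfold_locales; use finite_subset[OF sub finite_arcs[OF G]] symD[OF sym_arcs[of G]] in \<open>auto simp: H_def sym_def\<close>)+
  define d where "d v = real (card (H `` {v}))" for v
  have "H `` {v} = {u \<in> arcs G `` {v}. u \<in> S \<longleftrightarrow> v \<notin> S}" for v by (auto simp: H_def)
  then have deg: "real (degree G v) \<le> 2 * d v" if "v \<in> V" for v
    using S[of v] degree_eq_card_arcs[of v G] that by (simp add: d_def V_def)
  have dN: "d v \<le> N" for v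
  proof -
    have "H `` {v} \<subseteq> V" using sub arcs_subset[of G] by (auto simp: V_def)
    then show ?thesis unfolding d_def N_def using V by (intro of_nat_mono card_mono)
  qed
  have side: "(\<Sum>v\<in>V \<inter> Y. d v powr p) \<le> (C + 2 * C powr p) * N powr p" if Y: "bipartite H Y" for Y
    unfolding p_def
  proof (rule power_sum_le[OF t C])
    show "finite (V \<inter> Y)" using V by simp
    show "real (card (V \<inter> Y)) \<le> N" unfolding N_def using V by (intro of_nat_mono card_mono) auto
    show "0 \<le> d a" for a by (simp add: d_def)
    show "sum d U \<le> C * max ((real (card U) * N) powr ((t + 1) / (2 * t))) N"
      if "U \<subseteq> V \<inter> Y" "U \<noteq> {}" for U
      using sparse[OF Y sub _ that(2)] that(1) by (auto simp: d_def N_def V_def)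
  qed (rule dN)
  have "degree_power_sum p G \<le> (\<Sum>v\<in>V. 2 powr p * d v powr p)"
    unfolding degree_power_sum_def V_def[symmetric]
  proof (rule sum_mono)
    fix v assume "v \<in> V"
    then have "real (degree G v) powr p \<le> (2 * d v) powr p"
      using deg p by (intro powr_mono2) auto
    then show "real (degree G v) powr p \<le> 2 powr p * d v powr p" by (simp add: powr_mult d_def)
  qed
  also have "\<dots> = 2 powr p * ((\<Sum>v\<in>V \<inter> S. d v powr p) + (\<Sum>v\<in>V \<inter> - S. d v powr p))"
    using V by (subst sum.union_disjoint[symmetric])
      (auto simp: sum_distrib_left[symmetric] Int_Un_distrib[symmetric])
  also have "\<dots> \<le> 2 powr p * ((C + 2 * C powr p) * N powr p + (C + 2 * C powr p) * N powr p)"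
    using side[OF bip(1)] side[OF bip(2)] by (intro mult_left_mono add_mono) auto
  finally show ?thesis by (simp add: N_def V_def algebra_simps)
qed

lemma powr_le_sqrt_cube:
  fixes c p :: real
  assumes "1 \<le> c" "p \<le> 3 / 2"
  shows "c powr p \<le> c * sqrt c"
proof -
  have "c powr p \<le> c powr (1 + 1 / 2)" using assms by (intro powr_mono) auto
  also have "\<dots> = c * sqrt c" using assms unfolding powr_add by (simp add: powr_half_sqrt)
  finally show ?thesis .
qed

text \<open>As \<open>p \<le> 3 / 2\<close>, the constants \<open>2 powr p\<close> and
  \<open>12 powr p\<close> are at most 3 and 42.\<close>

lemma ex_even_cycles_le:
  fixes l n :: nat
  assumes l: "3 \<le> l"
  shows "ex (real l / (real l - 1)) n {cycle_graph (2 * k) | k. 2 \<le> k \<and> k \<le> l}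
    \<le> 765 * real n powr (real l / (real l - 1))"
proof (rule ex_le)
  define p where "p = real l / (real l - 1)"
  have p: "p \<le> 3 / 2" using l by (simp add: p_def field_simps)
  fix G :: "nat graph"
  assume G: "simple_graph G" "card (verts G) = n"
    and free: "\<forall>F\<in>{cycle_graph (2 * k) | k. 2 \<le> k \<and> k \<le> l}. \<not> contained_in F G"
  have "degree_power_sum p G \<le> 2 powr p * (2 * (12 + 2 * 12 powr p)) * card (verts G) powr p"
    unfolding p_def
  proof (rule degree_power_sum_le_of_bipartite[OF G(1)])
    fix H X U assume H: "bipartite H X" "H \<subseteq> arcs G" "U \<subseteq> X \<inter> verts G" "U \<noteq> {}"
    have "\<not> has_cycle H (2 * k)" if "2 \<le> k" "k \<le> l" for k
      using that free cycle_graph_contained_in[OF has_cycle_mono[OF _ H(2)], of "2 * k"] by auto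
    then show "real (\<Sum>u\<in>U. card (H `` {u})) \<le>
        12 * max ((real (card U) * card (verts G)) powr ((real l + 1) / (2 * real l))) (card (verts G))"
      using H G(1) l arcs_subset[of G]
      by (intro sum_card_neighbours_le_girth) (auto simp: simple_graph_def)
  qed (use l in auto)
  also have "2 powr p * (2 * (12 + 2 * 12 powr p)) * card (verts G) powr p \<le> 765 * n powr p"
    unfolding G(2)
  proof (rule mult_right_mono)
    have "sqrt 2 \<le> 3 / 2" "sqrt 12 \<le> 7 / 2"
      by (rule real_le_lsqrt; simp add: power2_eq_square)+
    then have "2 powr p \<le> 3" "12 powr p \<le> 42"
      using powr_le_sqrt_cube[of 2 p] powr_le_sqrt_cube[of 12 p] p by auto
    then have "2 powr p * (2 * (12 + 2 * 12 powr p)) \<le> 3 * (2 * (12 + 2 * 42))"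
      by (intro mult_mono) auto
    then show "2 powr p * (2 * (12 + 2 * 12 powr p)) \<le> 765" by simp
  qed simp
  finally show "degree_power_sum (real l / (real l - 1)) G \<le> 765 * real n powr (real l / (real l - 1))"
    by (simp add: p_def)
qed simp

lemma ex_C6_le:
  fixes n :: nat
  shows "ex (3 / 2) n {cycle_graph 6} \<le> 2164 * real n powr (3 / 2)"
proof (rule ex_le)
  fix G :: "nat graph"
  assume G: "simple_graph G" "card (verts G) = n" and free: "\<forall>F\<in>{cycle_graph 6}. \<not> contained_in F G"
  have "degree_power_sum (3 / (3 - 1)) G
      \<le> 2 powr (3 / (3 - 1)) * (2 * (24 + 2 * 24 powr (3 / (3 - 1)))) * card (verts G) powr (3 / (3 - 1))"
  proof (rule degree_power_sum_le_of_bipartite[OF G(1)])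
    fix H X U assume H: "bipartite H X" "H \<subseteq> arcs G" "U \<subseteq> X \<inter> verts G" "U \<noteq> {}"
    have "\<not> has_cycle H 6"
      using free cycle_graph_contained_in[OF has_cycle_mono[OF _ H(2)], of 6] by auto
    then have "real (\<Sum>u\<in>U. card (H `` {u})) \<le>
        24 * max ((real (card U) * card (verts G)) powr (2 / 3)) (card (verts G))"
      using H G(1) arcs_subset[of G]
      by (intro sum_card_neighbours_le_C6) (auto simp: simple_graph_def)
    then show "real (\<Sum>u\<in>U. card (H `` {u})) \<le>
        24 * max ((real (card U) * card (verts G)) powr ((3 + 1) / (2 * 3))) (card (verts G))" by simp
  qed auto
  then have "degree_power_sum (3 / 2) G \<le> 2 powr (3 / 2) * (2 * (24 + 2 * 24 powr (3 / 2))) * n powr (3 / 2)"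
    using G(2) by simp
  also have "\<dots> \<le> 2164 * n powr (3 / 2)"
  proof (rule mult_right_mono)
    have "sqrt 2 \<le> 3 / 2" "sqrt 24 \<le> 5"
      by (rule real_le_lsqrt; simp add: power2_eq_square)+
    then have "2 powr (3 / 2) \<le> (3::real)" "24 powr (3 / 2) \<le> (120::real)"
      using powr_le_sqrt_cube[of 2 "3 / 2"] powr_le_sqrt_cube[of 24 "3 / 2"] by auto
    then have "2 powr (3 / 2) * (2 * (24 + 2 * 24 powr (3 / 2))) \<le> 3 * (2 * (24 + 2 * (120::real)))"
      by (intro mult_mono) auto
    then show "2 powr (3 / 2) * (2 * (24 + 2 * 24 powr (3 / 2))) \<le> (2164::real)" by simp
  qed simp
  finally show "degree_power_sum (3 / 2) G \<le> 2164 * real n powr (3 / 2)" .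
qed simp

section \<open>Counting tuples with few common neighbours\<close>

lemma card_PiE_restrict_le:
  assumes "finite A" "finite B" "T \<subseteq> A"
  shows "card {\<phi> \<in> A \<rightarrow>\<^sub>E B. P (restrict \<phi> T)} \<le> card {g \<in> T \<rightarrow>\<^sub>E B. P g} * card B ^ card (A - T)"
proof -
  let ?L = "{\<phi> \<in> A \<rightarrow>\<^sub>E B. P (restrict \<phi> T)}"
  let ?R = "{g \<in> T \<rightarrow>\<^sub>E B. P g} \<times> (A - T \<rightarrow>\<^sub>E B)"
  have "finite T" using assms finite_subset by blast
  then have "finite (T \<rightarrow>\<^sub>E B)" "finite (A - T \<rightarrow>\<^sub>E B)"
    using assms by (simp_all add: finite_PiE)
  then have fin: "finite ?R" by simp
  have "inj_on (\<lambda>\<phi>. (restrict \<phi> T, restrict \<phi> (A - T))) ?L"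
  proof (rule inj_onI)
    fix \<phi> \<psi> assume mem: "\<phi> \<in> ?L" "\<psi> \<in> ?L"
      and eq: "(restrict \<phi> T, restrict \<phi> (A - T)) = (restrict \<psi> T, restrict \<psi> (A - T))"
    have "\<phi> x = \<psi> x" if "x \<in> A" for x
    proof (cases "x \<in> T")
      case True
      then show ?thesis using eq by (metis prod.inject restrict_apply')
    next
      case False
      then have "x \<in> A - T" using that by simp
      then show ?thesis using eq by (metis prod.inject restrict_apply')
    qed
    then show "\<phi> = \<psi>" using mem by (intro PiE_ext[of \<phi> A "\<lambda>_. B" \<psi>]) auto
  qed
  moreover have "(\<lambda>\<phi>. (restrict \<phi> T, restrict \<phi> (A - T))) ` ?L \<subseteq> ?R"
    using assms(3) by (auto simp: PiE_iff split: if_splits)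
  ultimately have "card ?L \<le> card ?R" using fin by (rule card_inj_on_le)
  also have "\<dots> = card {g \<in> T \<rightarrow>\<^sub>E B. P g} * card B ^ card (A - T)"
    using assms(1) by (simp add: card_cartesian_product card_funcsetE)
  finally show ?thesis .
qed

text \<open>A map identifying two given points is determined by its values away from one of
  them.\<close>

lemma card_not_inj_le:
  assumes "finite A" "finite B"
  shows "card {\<phi> \<in> A \<rightarrow>\<^sub>E B. \<not> inj_on \<phi> A} \<le> card A ^ 2 * card B ^ (card A - 1)"
proof -
  let ?C = "\<lambda>z. {\<phi> \<in> A \<rightarrow>\<^sub>E B. fst z \<noteq> snd z \<and> \<phi> (fst z) = \<phi> (snd z)}"
  have finA: "finite (A \<rightarrow>\<^sub>E B)" using assms by (intro finite_PiE) auto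
  have each: "card (?C z) \<le> card B ^ (card A - 1)" if z: "z \<in> A \<times> A" for z
  proof -
    obtain x y where xy: "z = (x, y)" "x \<in> A" "y \<in> A" using z by blast
    have "inj_on (\<lambda>\<phi>. restrict \<phi> (A - {y})) (?C z)"
    proof (rule inj_onI)
      fix \<phi> \<psi> assume mem: "\<phi> \<in> ?C z" "\<psi> \<in> ?C z"
        and eq: "restrict \<phi> (A - {y}) = restrict \<psi> (A - {y})"
      have off: "\<phi> u = \<psi> u" if "u \<in> A - {y}" for u using eq that by (metis restrict_apply')
      have "x \<in> A - {y}" using mem xy by auto
      from off[OF this] have "\<phi> y = \<psi> y" using mem xy by simp
      then have "\<phi> u = \<psi> u" if "u \<in> A" for u using off that by blast
      then show "\<phi> = \<psi>" using mem by (intro PiE_ext[of \<phi> A "\<lambda>_. B" \<psi>]) auto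
    qed
    moreover have "(\<lambda>\<phi>. restrict \<phi> (A - {y})) ` ?C z \<subseteq> (A - {y} \<rightarrow>\<^sub>E B)"
      by (auto simp: PiE_iff split: if_splits)
    moreover have "finite (A - {y} \<rightarrow>\<^sub>E B)" using assms by (intro finite_PiE) auto
    ultimately have "card (?C z) \<le> card (A - {y} \<rightarrow>\<^sub>E B)" by (rule card_inj_on_le)
    then show ?thesis using assms xy by (simp add: card_funcsetE)
  qed
  have "card {\<phi> \<in> A \<rightarrow>\<^sub>E B. \<not> inj_on \<phi> A} \<le> card (\<Union>z\<in>A \<times> A. ?C z)"
    using assms finA by (intro card_mono) (auto simp: inj_on_def)
  also have "\<dots> \<le> (\<Sum>z\<in>A \<times> A. card (?C z))" using assms by (intro card_UN_le) auto
  also have "\<dots> \<le> (\<Sum>z\<in>A \<times> A. card B ^ (card A - 1))" using each by (rule sum_mono)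
  finally show ?thesis by (simp add: card_cartesian_product power2_eq_square)
qed

lemma sum_card_swap:
  assumes "finite A" "finite B"
  shows "(\<Sum>a\<in>A. card {b \<in> B. R a b}) = (\<Sum>b\<in>B. card {a \<in> A. R a b})"
proof -
  show ?thesis using assms sum.swap[of "\<lambda>a b. if R a b then 1 else 0 :: nat" B A]
    by (simp add: sum.If_cases Int_def)
qed

text \<open>Fix \<open>v\<close> of degree \<open>d\<close>. If \<open>d\<close> is at least twice the square of \<open>a = card A\<close>, at most
  half of the \<open>d ^ a\<close> maps from \<open>A\<close> to its neighbourhood are not injective. Each of the others
  restricts, for some \<open>i\<close>, to a bad map on \<open>T i\<close>, that is, one whose image has at most \<open>c i\<close> common neighbours; and a
  map on \<open>T i\<close> has only \<open>d ^ (a - s)\<close> extensions. So there are at least \<open>d ^ s / 2\<close> bad maps.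
  In total over all \<open>v\<close> a bad map on \<open>T i\<close> is counted at most \<open>c i\<close> times, once for each common
  neighbour of its image.\<close>

lemma sum_degree_power_le:
  fixes E :: "('v \<times> 'v) set" and A :: "'b set" and T :: "'i \<Rightarrow> 'b set"
  assumes V: "finite V" "E \<subseteq> V \<times> V" and A: "finite A" and I: "finite I" and s: "0 < s"
    and T: "\<And>i. i \<in> I \<Longrightarrow> T i \<subseteq> A" "\<And>i. i \<in> I \<Longrightarrow> card (T i) = s" and sA: "s \<le> card A"
    and none: "\<And>v \<phi>. \<lbrakk>v \<in> V; \<phi> \<in> A \<rightarrow> E `` {v}; inj_on \<phi> A\<rbrakk> \<Longrightarrow>
      \<exists>i\<in>I. card {w \<in> V. \<phi> ` T i \<subseteq> E `` {w}} \<le> c i"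
  shows "(\<Sum>v\<in>V. card (E `` {v}) ^ s) \<le>
    2 * (\<Sum>i\<in>I. c i) * card V ^ s + card V * (2 * card A ^ 2) ^ s"
proof -
  define codeg where "codeg i g = card {w \<in> V. g ` T i \<subseteq> E `` {w}}" for i and g :: "'b \<Rightarrow> 'v"
  define bad where "bad i v = card {g \<in> T i \<rightarrow>\<^sub>E E `` {v}. codeg i g \<le> c i}" for i v
  have finT: "finite (T i)" if "i \<in> I" for i using T(1)[OF that] A finite_subset by blast
  have finN: "finite (E `` {v})" for v
    by (rule finite_subset[OF _ V(1)]) (use V(2) in auto)
  have vertex: "card (E `` {v}) ^ s \<le> 2 * (\<Sum>i\<in>I. bad i v) + (2 * card A ^ 2) ^ s" if v: "v \<in> V" for v
  proof (cases "card (E `` {v}) < 2 * card A ^ 2")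
    case True
    then have "card (E `` {v}) ^ s \<le> (2 * card A ^ 2) ^ s" by (intro power_mono) auto
    then show ?thesis by (rule trans_le_add2)
  next
    case False
    define d a where "d = card (E `` {v})" and "a = card A"
    have a: "0 < a" using s sA by (simp add: a_def)
    have d: "2 * a ^ 2 \<le> d" using False by (simp add: d_def a_def)
    then have d0: "0 < d" using a by (metis gr0I le_zero_eq mult_is_0 power_not_zero zero_neq_numeral)
    let ?P = "A \<rightarrow>\<^sub>E E `` {v}"
    let ?N = "{\<phi> \<in> ?P. \<not> inj_on \<phi> A}" and ?B = "\<lambda>i. {\<phi> \<in> ?P. codeg i (restrict \<phi> (T i)) \<le> c i}"
    have finP: "finite ?P" using A finN by (intro finite_PiE) auto
    have "d ^ a = card ?P" using A by (simp add: card_funcsetE d_def a_def)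
    also have "\<dots> \<le> card (?N \<union> (\<Union>i\<in>I. ?B i))"
    proof (rule card_mono)
      show "finite (?N \<union> (\<Union>i\<in>I. ?B i))" using finP I by simp
      show "?P \<subseteq> ?N \<union> (\<Union>i\<in>I. ?B i)"
      proof
        fix \<phi> assume \<phi>: "\<phi> \<in> ?P"
        show "\<phi> \<in> ?N \<union> (\<Union>i\<in>I. ?B i)"
        proof (cases "inj_on \<phi> A")
          case True
          then obtain i where i: "i \<in> I" "card {w \<in> V. \<phi> ` T i \<subseteq> E `` {w}} \<le> c i"
            using none[OF v _ True] \<phi> by (auto simp: PiE_iff)
          then have "codeg i (restrict \<phi> (T i)) \<le> c i" by (simp add: codeg_def)
          then show ?thesis using \<phi> i by blast
        qed (use \<phi> in simp)
      qed
    qed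
    also have "\<dots> \<le> card ?N + card (\<Union>i\<in>I. ?B i)" by (rule card_Un_le)
    also have "\<dots> \<le> a ^ 2 * d ^ (a - 1) + (\<Sum>i\<in>I. bad i v) * d ^ (a - s)"
    proof (rule add_mono)
      show "card ?N \<le> a ^ 2 * d ^ (a - 1)"
        unfolding a_def d_def by (rule card_not_inj_le[OF A finN])
      have "card (\<Union>i\<in>I. ?B i) \<le> (\<Sum>i\<in>I. card (?B i))" by (rule card_UN_le[OF I])
      also have "\<dots> \<le> (\<Sum>i\<in>I. bad i v * d ^ (a - s))"
      proof (rule sum_mono)
        fix i assume i: "i \<in> I"
        have "card (A - T i) = a - s" using T[OF i] finT[OF i] by (simp add: card_Diff_subset a_def)
        then show "card (?B i) \<le> bad i v * d ^ (a - s)"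
          using card_PiE_restrict_le[OF A finN T(1)[OF i], where P = "\<lambda>g. codeg i g \<le> c i"]
          by (simp add: bad_def d_def)
      qed
      finally show "card (\<Union>i\<in>I. ?B i) \<le> (\<Sum>i\<in>I. bad i v) * d ^ (a - s)"
        by (simp add: sum_distrib_right)
    qed
    finally have "2 * d ^ a \<le> 2 * a ^ 2 * d ^ (a - 1) + 2 * (\<Sum>i\<in>I. bad i v) * d ^ (a - s)" by simp
    also have "2 * a ^ 2 * d ^ (a - 1) \<le> d * d ^ (a - 1)" using d by (rule mult_right_mono) simp
    also have "d * d ^ (a - 1) = d ^ a" using a by (simp add: power_eq_if)
    finally have "d ^ a \<le> 2 * (\<Sum>i\<in>I. bad i v) * d ^ (a - s)" by simp
    moreover have "d ^ a = d ^ s * d ^ (a - s)" using sA by (simp add: a_def flip: power_add)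
    ultimately have "d ^ s \<le> 2 * (\<Sum>i\<in>I. bad i v)" using d0 by simp
    then show ?thesis by (simp add: d_def)
  qed
  have bad_sum: "(\<Sum>v\<in>V. bad i v) \<le> c i * card V ^ s" if i: "i \<in> I" for i
  proof -
    let ?Q = "T i \<rightarrow>\<^sub>E V"
    have finQ: "finite ?Q" using finT[OF i] V(1) by (intro finite_PiE) auto
    have "{g \<in> T i \<rightarrow>\<^sub>E E `` {v}. codeg i g \<le> c i} =
        {g \<in> ?Q. g ` T i \<subseteq> E `` {v} \<and> codeg i g \<le> c i}" for v
      using V(2) by (auto simp: PiE_iff)
    then have "(\<Sum>v\<in>V. bad i v) = (\<Sum>v\<in>V. card {g \<in> ?Q. g ` T i \<subseteq> E `` {v} \<and> codeg i g \<le> c i})"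
      by (simp add: bad_def)
    also have "\<dots> = (\<Sum>g\<in>?Q. card {v \<in> V. g ` T i \<subseteq> E `` {v} \<and> codeg i g \<le> c i})"
      by (rule sum_card_swap[OF V(1) finQ])
    also have "\<dots> \<le> (\<Sum>g\<in>?Q. c i)"
    proof (rule sum_mono)
      fix g
      show "card {v \<in> V. g ` T i \<subseteq> E `` {v} \<and> codeg i g \<le> c i} \<le> c i"
        by (cases "codeg i g \<le> c i") (simp_all add: codeg_def)
    qed
    also have "\<dots> = c i * card V ^ s" using finT[OF i] T(2)[OF i] by (simp add: card_funcsetE)
    finally show ?thesis .
  qed
  have "(\<Sum>v\<in>V. card (E `` {v}) ^ s) \<le> (\<Sum>v\<in>V. 2 * (\<Sum>i\<in>I. bad i v) + (2 * card A ^ 2) ^ s)"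
    using vertex by (rule sum_mono)
  also have "\<dots> = 2 * (\<Sum>i\<in>I. \<Sum>v\<in>V. bad i v) + card V * (2 * card A ^ 2) ^ s"
    by (simp add: sum.distrib sum_distrib_left[symmetric] sum.swap[of "\<lambda>v i. bad i v" I V])
  also have "\<dots> \<le> 2 * (\<Sum>i\<in>I. c i * card V ^ s) + card V * (2 * card A ^ 2) ^ s"
    using bad_sum by (intro add_mono mult_left_mono sum_mono) auto
  finally show ?thesis unfolding sum_distrib_right[symmetric] by (simp only: mult.assoc)
qed

lemma greedy_representatives:
  fixes k :: nat
  assumes "finite B" "\<And>i. i < k \<Longrightarrow> card B + i < card (W i)"
  shows "\<exists>g. inj_on g {..<k} \<and> (\<forall>i<k. g i \<in> W i - B)"
  using assms(2)
proof (induction k)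
  case (Suc k)
  then obtain g where g: "inj_on g {..<k}" "\<forall>i<k. g i \<in> W i - B" by auto
  have "card (B \<union> g ` {..<k}) \<le> card B + k"
    using card_Un_le[of B "g ` {..<k}"] card_image_le[of "{..<k}" g] by simp
  also have "\<dots> < card (W k)" using Suc.prems by simp
  finally have "\<not> W k \<subseteq> B \<union> g ` {..<k}"
    using card_mono[of "B \<union> g ` {..<k}" "W k"] assms(1) by auto
  then obtain w where w: "w \<in> W k" "w \<notin> B" "w \<notin> g ` {..<k}" by blast
  have "inj_on (g(k := w)) {..<Suc k}"
    using g(1) w(3) by (auto simp: inj_on_def less_Suc_eq)
  moreover have "\<forall>i<Suc k. (g(k := w)) i \<in> W i - B" using g(2) w by (auto simp: less_Suc_eq)
  ultimately show ?case by blast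
qed simp

text \<open>With \<open>V1\<close> embedded by \<open>\<phi>\<close>, the vertices of \<open>V2\<close> are embedded one
  by one: the \<open>i\<close>-th one has to avoid the \<open>card V1\<close> images of \<open>V1\<close> and the \<open>i\<close> vertices chosen
  before it.\<close>

lemma contained_in_of_candidates:
  fixes F :: "'a graph" and G :: "'b graph"
  assumes F: "V1 \<union> V2 = verts F" "V1 \<inter> V2 = {}" "\<forall>e\<in>edges F. \<exists>x\<in>V1. \<exists>y\<in>V2. e = {x, y}"
    and fin: "finite V1" and h: "bij_betw h {..<k} V2"
    and \<phi>: "inj_on \<phi> V1" "\<phi> ` V1 \<subseteq> verts G"
    and W: "\<And>i. i < k \<Longrightarrow> W i \<subseteq> verts G" "\<And>i. i < k \<Longrightarrow> card V1 + i < card (W i)"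
      "\<And>i x w. \<lbrakk>i < k; x \<in> V1; {x, h i} \<in> edges F; w \<in> W i\<rbrakk> \<Longrightarrow> (\<phi> x, w) \<in> arcs G"
  shows "contained_in F G"
proof -
  have "card (\<phi> ` V1) = card V1" using \<phi>(1) by (rule card_image)
  then obtain g where g: "inj_on g {..<k}" "\<And>i. i < k \<Longrightarrow> g i \<in> W i - \<phi> ` V1"
    using greedy_representatives[of "\<phi> ` V1" k W] W(2) fin by auto
  define h' where "h' = the_inv_into {..<k} h"
  have h': "h' y < k" "h (h' y) = y" if "y \<in> V2" for y
    using that h the_inv_into_into[of h "{..<k}" y "{..<k}"] f_the_inv_into_f[of h "{..<k}" y]
    by (auto simp: h'_def bij_betw_def)
  define f where "f z = (if z \<in> V1 then \<phi> z else g (h' z))" for z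
  have f1: "f x = \<phi> x" if "x \<in> V1" for x using that by (simp add: f_def)
  have f2: "f y = g (h' y)" if "y \<in> V2" for y using that F(2) by (auto simp: f_def)
  have "inj_on f V2"
  proof (rule inj_onI)
    fix x y assume xy: "x \<in> V2" "y \<in> V2" "f x = f y"
    then have "h' x = h' y" using g(1) h' f2 by (auto simp: inj_on_def)
    then show "x = y" using h'(2) xy by metis
  qed
  moreover have "inj_on f V1" using \<phi>(1) inj_on_cong[of V1 f \<phi>] f1 by simp
  moreover have "f x \<noteq> f y" if "x \<in> V1" "y \<in> V2" for x y
    using g(2)[OF h'(1)[OF that(2)]] f1[OF that(1)] f2[OF that(2)] imageI[OF that(1), of \<phi>]
    by auto
  ultimately have "inj_on f (verts F)"
    unfolding F(1)[symmetric] inj_on_Un by blast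
  moreover have "f ` verts F \<subseteq> verts G"
  proof -
    have "f x \<in> verts G" if "x \<in> V1" for x using f1[OF that] \<phi>(2) that by auto
    moreover have "f y \<in> verts G" if "y \<in> V2" for y
      using f2[OF that] g(2)[OF h'(1)[OF that]] W(1)[OF h'(1)[OF that]] by auto
    ultimately show ?thesis unfolding F(1)[symmetric] by auto
  qed
  moreover have "f ` e \<in> edges G" if e: "e \<in> edges F" for e
  proof -
    obtain x y where xy: "x \<in> V1" "y \<in> V2" "e = {x, y}" using F(3) e by blast
    have "(\<phi> x, g (h' y)) \<in> arcs G"
      using W(3)[OF h'(1)[OF xy(2)] xy(1)] h'[OF xy(2)] g(2)[OF h'(1)[OF xy(2)]] xy e by auto
    then show ?thesis using xy f1 f2 by (simp add: arcs_def)
  qed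
  ultimately show ?thesis unfolding contained_in_def by blast
qed

section \<open>Graphs without a bounded bipartite subgraph\<close>

lemma degree_power_sum_of_nat:
  assumes "0 < s"
  shows "degree_power_sum (real s) G = real (\<Sum>v\<in>verts G. card (arcs G `` {v}) ^ s)"
proof -
  have "real d powr real s = real d ^ s" for d :: nat
    using assms by (cases "d = 0") (simp_all add: powr_realpow)
  then show ?thesis unfolding degree_power_sum_def by (simp add: degree_eq_card_arcs)
qed

lemma card_arcs_Image_le: "finite (verts G) \<Longrightarrow> card (arcs G `` S) \<le> card (verts G)"
  using arcs_subset[of G] by (intro card_mono) auto

locale bipartite_pattern =
  fixes F :: "'a graph" and V1 V2 :: "'a set" and s :: nat
  assumes simple: "simple_graph F"
    and parts: "V1 \<union> V2 = verts F" "V1 \<inter> V2 = {}"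
    and edges: "\<forall>e\<in>edges F. \<exists>x\<in>V1. \<exists>y\<in>V2. e = {x, y}"
    and degree_le: "\<forall>v\<in>V2. degree F v \<le> s"
begin

lemma finite_parts: "finite V1" "finite V2"
  using simple finite_subset[of _ "verts F"] parts(1) by (auto simp: simple_graph_def)

lemma card_verts: "card (verts F) = card V1 + card V2"
  using finite_parts parts by (simp add: card_Un_disjoint flip: parts(1))

definition nbrs :: "'a \<Rightarrow> 'a set" where
  "nbrs y = {x \<in> V1. {x, y} \<in> edges F}"

lemma card_nbrs_le: "y \<in> V2 \<Longrightarrow> card (nbrs y) \<le> s"
proof -
  assume y: "y \<in> V2"
  have "card (nbrs y) \<le> degree F y"
    unfolding degree_def using simple parts(1)
    by (intro card_mono) (auto simp: nbrs_def simple_graph_def)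
  then show ?thesis using degree_le y by fastforce
qed

text \<open>Every vertex of \<open>V2\<close> has at most one neighbour, so \<open>V1\<close> may be mapped
  to any vertices of degree at least \<open>card (verts F)\<close>. Hence a large graph without \<open>F\<close> has fewer than \<open>card V1\<close> such vertices.\<close>

lemma degree_sum_le_of_star_forest:
  assumes G: "simple_graph G" and free: "\<not> contained_in F G"
    and n: "card (verts F) \<le> card (verts G)" and s: "s = 1"
  shows "(\<Sum>v\<in>verts G. card (arcs G `` {v})) \<le> 2 * card (verts F) * card (verts G)"
proof -
  define k where "k = card (verts F)"
  define good where "good = {v \<in> verts G. k \<le> card (arcs G `` {v})}"
  have fin: "finite (verts G)" using G by (simp add: simple_graph_def)
  have sub: "good \<subseteq> verts G" by (auto simp: good_def)
  then have fin_good: "finite good" using fin finite_subset by blast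
  have "card good < card V1"
  proof (rule ccontr)
    assume "\<not> card good < card V1"
    then obtain \<phi> where \<phi>: "\<phi> ` V1 \<subseteq> good" "inj_on \<phi> V1"
      using card_le_inj[OF finite_parts(1) fin_good] by auto
    obtain h where h: "bij_betw h {..<card V2} V2"
      using ex_bij_betw_nat_finite[OF finite_parts(2)] by (auto simp: atLeast0LessThan)
    define W where "W i = (if nbrs (h i) = {} then verts G else arcs G `` (\<phi> ` nbrs (h i)))" for i
    have hV: "h i \<in> V2" if "i < card V2" for i using h that by (auto simp: bij_betw_def)
    have single: "nbrs (h i) = {x}" if "i < card V2" "x \<in> nbrs (h i)" for i x
    proof -
      have "finite (nbrs (h i))" using finite_parts(1) by (simp add: nbrs_def)
      then show ?thesis using card_nbrs_le[OF hV[OF that(1)]] that(2) s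
        by (metis One_nat_def card_le_Suc0_iff_eq subset_singleton_iff subsetI singletonI empty_iff)
    qed
    have "contained_in F G"
    proof (rule contained_in_of_candidates[OF parts edges finite_parts(1) h \<phi>(2)])
      show "\<phi> ` V1 \<subseteq> verts G" using \<phi>(1) sub by blast
      fix i assume i: "i < card V2"
      show "W i \<subseteq> verts G" using arcs_subset[of G] by (auto simp: W_def)
      show "card V1 + i < card (W i)"
      proof (cases "nbrs (h i) = {}")
        case True
        then show ?thesis using n i by (simp add: W_def card_verts)
      next
        case False
        then obtain x where x: "x \<in> nbrs (h i)" by blast
        then have "\<phi> x \<in> good" using \<phi>(1) by (auto simp: nbrs_def)
        then have "k \<le> card (arcs G `` {\<phi> x})" by (simp add: good_def)
        then show ?thesis using i single[OF i x] by (simp add: W_def k_def card_verts)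
      qed
      fix x w assume x: "x \<in> V1" "{x, h i} \<in> edges F" and w: "w \<in> W i"
      then have "x \<in> nbrs (h i)" by (simp add: nbrs_def)
      from single[OF i this] show "(\<phi> x, w) \<in> arcs G" using w by (simp add: W_def)
    qed
    then show False using free by simp
  qed
  then have good: "card good \<le> k" by (simp add: k_def card_verts)
  have "(\<Sum>v\<in>verts G. card (arcs G `` {v})) =
      (\<Sum>v\<in>verts G - good. card (arcs G `` {v})) + (\<Sum>v\<in>good. card (arcs G `` {v}))"
    using sum.subset_diff[OF sub fin] .
  also have "\<dots> \<le> (\<Sum>v\<in>verts G - good. k) + (\<Sum>v\<in>good. card (verts G))"
    using card_arcs_Image_le[OF fin] by (intro add_mono sum_mono) (auto simp: good_def)
  also have "\<dots> \<le> card (verts G) * k + k * card (verts G)"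
    using good fin by (auto intro!: add_mono mult_right_mono card_mono)
  finally show ?thesis by (simp add: k_def mult_2 algebra_simps)
qed

text \<open>The index set of the counted maps is \<open>V1\<close> itself, and \<open>T i\<close> is
  the neighbourhood of the \<open>i\<close>-th vertex of \<open>V2\<close>, enlarged to exactly \<open>s\<close> elements.\<close>

lemma degree_power_sum_le_large_part:
  assumes G: "simple_graph G" and free: "\<not> contained_in F G" and s: "0 < s" "s \<le> card V1"
  shows "(\<Sum>v\<in>verts G. card (arcs G `` {v}) ^ s) \<le>
    card (verts F) ^ 2 * card (verts G) ^ s + card (verts G) * (2 * card V1 ^ 2) ^ s"
proof -
  have fin: "finite (verts G)" using G by (simp add: simple_graph_def)
  obtain h where h: "bij_betw h {..<card V2} V2"
    using ex_bij_betw_nat_finite[OF finite_parts(2)] by (auto simp: atLeast0LessThan)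
  have "\<exists>T. nbrs (h i) \<subseteq> T \<and> T \<subseteq> V1 \<and> card T = s" if "i < card V2" for i
  proof -
    have "h i \<in> V2" using h that by (auto simp: bij_betw_def)
    then show ?thesis
      using exists_subset_between[of "nbrs (h i)" s V1] card_nbrs_le[of "h i"] s finite_parts(1)
      by (auto simp: nbrs_def)
  qed
  then obtain T where T: "\<And>i. i < card V2 \<Longrightarrow> nbrs (h i) \<subseteq> T i \<and> T i \<subseteq> V1 \<and> card (T i) = s"
    by metis
  have "(\<Sum>v\<in>verts G. card (arcs G `` {v}) ^ s) \<le>
      2 * (\<Sum>i<card V2. card V1 + i) * card (verts G) ^ s + card (verts G) * (2 * card V1 ^ 2) ^ s"
  proof (rule sum_degree_power_le[OF fin arcs_subset finite_parts(1) _ s(1), where T = T])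
    fix v \<phi> assume v: "v \<in> verts G" and \<phi>: "\<phi> \<in> V1 \<rightarrow> arcs G `` {v}" and inj: "inj_on \<phi> V1"
    let ?W = "\<lambda>i. {w \<in> verts G. \<phi> ` T i \<subseteq> arcs G `` {w}}"
    show "\<exists>i\<in>{..<card V2}. card (?W i) \<le> card V1 + i"
    proof (rule ccontr)
      assume "\<not> ?thesis"
      then have big: "card V1 + i < card (?W i)" if "i < card V2" for i using that by force
      have "contained_in F G"
      proof (rule contained_in_of_candidates[OF parts edges finite_parts(1) h inj _ _ big])
        show "\<phi> ` V1 \<subseteq> verts G" using \<phi> arcs_subset[of G] by fastforce
        fix i x w assume i: "i < card V2" and x: "x \<in> V1" "{x, h i} \<in> edges F" and w: "w \<in> ?W i"
        have "x \<in> T i" using T[OF i] x by (auto simp: nbrs_def)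
        then have "(w, \<phi> x) \<in> arcs G" using w by auto
        then show "(\<phi> x, w) \<in> arcs G" by (rule symD[OF sym_arcs])
      qed auto
      then show False using free by simp
    qed
  qed (use T s in auto)
  also have "2 * (\<Sum>i<card V2. card V1 + i) \<le> card (verts F) ^ 2"
  proof -
    have "2 * (\<Sum>i<k. card V1 + i) \<le> (card V1 + k) ^ 2" for k
      by (induction k) (auto simp: power2_eq_square algebra_simps)
    then show ?thesis by (simp add: card_verts)
  qed
  finally show ?thesis by simp
qed

text \<open>Here \<open>V1\<close> fits into the image of a single \<open>s\<close>-tuple, and any
  \<open>card (verts F)\<close> common neighbours of that tuple leave enough room for \<open>V2\<close> outside the image
  of \<open>V1\<close>.\<close>

lemma degree_power_sum_le_small_part:
  assumes G: "simple_graph G" and free: "\<not> contained_in F G" and s: "0 < s" "card V1 < s"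
  shows "(\<Sum>v\<in>verts G. card (arcs G `` {v}) ^ s) \<le>
    2 * card (verts F) * card (verts G) ^ s + card (verts G) * (2 * s ^ 2) ^ s"
proof -
  have fin: "finite (verts G)" using G by (simp add: simple_graph_def)
  obtain h where h: "bij_betw h {..<card V2} V2"
    using ex_bij_betw_nat_finite[OF finite_parts(2)] by (auto simp: atLeast0LessThan)
  obtain j where j: "j ` V1 \<subseteq> {..<s}" "inj_on j V1"
    using card_le_inj[OF finite_parts(1), of "{..<s}"] s(2) by auto
  have "(\<Sum>v\<in>verts G. card (arcs G `` {v}) ^ s) \<le>
      2 * (\<Sum>i\<in>{()}. card (verts F)) * card (verts G) ^ s + card (verts G) * (2 * card {..<s} ^ 2) ^ s"
  proof (rule sum_degree_power_le[OF fin arcs_subset _ _ s(1), where T = "\<lambda>_. {..<s}"])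
    fix v and \<phi> :: "nat \<Rightarrow> _"
    assume v: "v \<in> verts G" and \<phi>: "\<phi> \<in> {..<s} \<rightarrow> arcs G `` {v}" and inj: "inj_on \<phi> {..<s}"
    let ?W = "{w \<in> verts G. \<phi> ` {..<s} \<subseteq> arcs G `` {w}}"
    show "\<exists>i\<in>{()}. card ?W \<le> card (verts F)"
    proof (rule ccontr)
      assume "\<not> ?thesis"
      then have big: "card V1 + i < card ?W" if "i < card V2" for i
        using that by (simp add: card_verts)
      have "contained_in F G"
      proof (rule contained_in_of_candidates[OF parts edges finite_parts(1) h _ _ _ big])
        show "inj_on (\<phi> \<circ> j) V1" using j inj by (auto intro: comp_inj_on inj_on_subset)
        show "(\<phi> \<circ> j) ` V1 \<subseteq> verts G" using \<phi> j(1) arcs_subset[of G] by fastforce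
        fix i x w assume x: "x \<in> V1" and w: "w \<in> ?W"
        have "(w, \<phi> (j x)) \<in> arcs G" using w j(1) x by auto
        then show "((\<phi> \<circ> j) x, w) \<in> arcs G" using symD[OF sym_arcs] by fastforce
      qed auto
      then show False using free by simp
    qed
  qed auto
  then show ?thesis by simp
qed

end

lemma fact_mult_square_le: "2 \<le> s \<Longrightarrow> s \<le> h \<Longrightarrow> fact s * h ^ 2 \<le> 2 * h ^ s" for s h :: nat
proof (induction s rule: nat_induct_at_least)
  case (Suc s)
  have "fact (Suc s) * h ^ 2 = Suc s * (fact s * h ^ 2)" by (simp add: algebra_simps)
  also have "\<dots> \<le> h * (2 * h ^ s)"
    by (rule mult_le_mono[OF Suc.prems]) (use Suc in simp)
  finally show ?case by simp
qed simp

text \<open>The factor in the two cases for \<open>s \<ge> 2\<close> is one of the two summands of the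
  claimed constant; the other summand absorbs the vertices of bounded degree once \<open>n\<close> is large.\<close>

lemma ex_bounded_bipartite_le:
  fixes F :: "'a graph" and s :: nat
  assumes s: "1 \<le> s" and F: "bounded_bipartite s F"
  shows "\<forall>\<^sub>F n in sequentially. ex (real s) n {F}
    \<le> 2 * (real (card (verts F)) ^ s / fact s + real (card (verts F))) * real n ^ s"
proof -
  obtain V1 V2 where "bipartite_pattern F V1 V2 s"
    using F by (auto simp: bounded_bipartite_def bipartite_pattern_def)
  then interpret bipartite_pattern F V1 V2 s .
  define h where "h = card (verts F)"
  define K where "K = 2 * (real h ^ s / fact s + real h)"
  have K: "0 \<le> K" by (simp add: K_def)
  obtain n0 where n0: "\<And>(G :: nat graph). \<lbrakk>simple_graph G; n0 \<le> card (verts G); \<not> contained_in F G\<rbrakk> \<Longrightarrow>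
      real (\<Sum>v\<in>verts G. card (arcs G `` {v}) ^ s) \<le> K * real (card (verts G)) ^ s"
  proof (cases "s = 1")
    case True
    show ?thesis
    proof (rule that[of h])
      fix G :: "nat graph" assume G: "simple_graph G" "h \<le> card (verts G)" "\<not> contained_in F G"
      have "real (\<Sum>v\<in>verts G. card (arcs G `` {v}) ^ s) \<le> real (2 * h * card (verts G))"
        using degree_sum_le_of_star_forest[OF G(1,3)] G(2) True unfolding h_def by (intro of_nat_mono) simp
      also have "\<dots> \<le> K * real (card (verts G)) ^ s" using True by (simp add: K_def mult_right_mono)
      finally show "real (\<Sum>v\<in>verts G. card (arcs G `` {v}) ^ s) \<le> K * real (card (verts G)) ^ s" .
    qed
  next
    case False
    then have s2: "2 \<le> s" using s by simp
    define D where "D = max ((2 * card V1 ^ 2) ^ s) ((2 * s ^ 2) ^ s)"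
    \<comment> \<open>Since \<open>s \<ge> 2\<close>, the linear contribution of the low-degree vertices is eventually
      below any fixed positive multiple of \<open>n ^ s\<close>.\<close>
    have low: "real (n * D) \<le> c * real n ^ s" if c: "0 < c" "real D / c \<le> real n" for n and c :: real
    proof -
      have "real D \<le> c * real n" using c by (simp add: divide_le_eq mult.commute)
      then have "real n * real D \<le> real n * (c * real n)" by (intro mult_left_mono) auto
      also have "\<dots> = c * real n ^ 2" by (simp add: power2_eq_square)
      also have "\<dots> \<le> c * real n ^ s"
      proof (cases "n = 0")
        case False
        then show ?thesis using c s2 by (intro mult_left_mono power_increasing) auto
      qed (use s2 c in simp)
      finally show ?thesis by simp
    qed
    show ?thesis
    proof (cases "h = 0")
      case True
      then have "verts F = {}" using simple by (simp add: h_def simple_graph_def)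
      moreover from this have "edges F = {}" using edges parts by auto
      ultimately have "contained_in F G" for G :: "nat graph" by (simp add: contained_in_def)
      then show ?thesis by (intro that[of 0]) auto
    next
      case False
      define c where "c = min (2 * real h) (2 * (real h ^ s / fact s))"
      have c: "0 < c" using False by (simp add: c_def)
      show ?thesis
      proof (rule that[of "nat \<lceil>real D / c\<rceil>"])
        fix G :: "nat graph"
        assume G: "simple_graph G" "nat \<lceil>real D / c\<rceil> \<le> card (verts G)" "\<not> contained_in F G"
        let ?n = "card (verts G)"
        have lowG: "real (?n * D) \<le> c * real ?n ^ s" using G(2) by (intro low[OF c]) linarith
        show "real (\<Sum>v\<in>verts G. card (arcs G `` {v}) ^ s) \<le> K * real ?n ^ s"
        proof (cases "s \<le> card V1")
          case True
          have "(\<Sum>v\<in>verts G. card (arcs G `` {v}) ^ s) \<le> h ^ 2 * ?n ^ s + ?n * (2 * card V1 ^ 2) ^ s"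
            unfolding h_def using degree_power_sum_le_large_part[OF G(1,3) _ True] s by simp
          also have "\<dots> \<le> h ^ 2 * ?n ^ s + ?n * D"
            by (intro add_left_mono mult_left_mono) (auto simp: D_def)
          finally have "real (\<Sum>v\<in>verts G. card (arcs G `` {v}) ^ s) \<le> real (h ^ 2 * ?n ^ s + ?n * D)"
            by (rule of_nat_mono)
          also have "\<dots> \<le> 2 * (real h ^ s / fact s) * real ?n ^ s + 2 * real h * real ?n ^ s"
          proof -
            have "s \<le> h" using True by (simp add: h_def card_verts)
            then have "real (fact s * h ^ 2) \<le> real (2 * h ^ s)"
              using fact_mult_square_le[OF s2] by (intro of_nat_mono)
            then have "real h ^ 2 \<le> 2 * (real h ^ s / fact s)" by (simp add: field_simps)
            then have "real h ^ 2 * real ?n ^ s \<le> 2 * (real h ^ s / fact s) * real ?n ^ s"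
              by (rule mult_right_mono) simp
            moreover have "c * real ?n ^ s \<le> 2 * real h * real ?n ^ s"
              by (rule mult_right_mono) (auto simp: c_def)
            ultimately show ?thesis using lowG by simp
          qed
          also have "\<dots> = K * real ?n ^ s" by (simp add: K_def algebra_simps)
          finally show ?thesis .
        next
          case False
          have "(\<Sum>v\<in>verts G. card (arcs G `` {v}) ^ s) \<le> 2 * h * ?n ^ s + ?n * (2 * s ^ 2) ^ s"
            unfolding h_def using degree_power_sum_le_small_part[OF G(1,3)] False s by simp
          also have "\<dots> \<le> 2 * h * ?n ^ s + ?n * D"
            by (intro add_left_mono mult_left_mono) (auto simp: D_def)
          finally have "real (\<Sum>v\<in>verts G. card (arcs G `` {v}) ^ s) \<le> real (2 * h * ?n ^ s + ?n * D)"
            by (rule of_nat_mono)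
          also have "\<dots> \<le> 2 * real h * real ?n ^ s + 2 * (real h ^ s / fact s) * real ?n ^ s"
          proof -
            have "c * real ?n ^ s \<le> 2 * (real h ^ s / fact s) * real ?n ^ s"
              by (rule mult_right_mono) (auto simp: c_def)
            then show ?thesis using lowG by simp
          qed
          also have "\<dots> = K * real ?n ^ s" by (simp add: K_def algebra_simps)
          finally show ?thesis .
        qed
      qed
    qed
  qed
  have "ex (real s) n {F} \<le> K * real n ^ s" if "n0 \<le> n" for n
  proof (rule ex_le)
    show "0 \<le> K * real n ^ s" using K by simp
    fix G :: "nat graph"
    assume "simple_graph G" "card (verts G) = n" "\<forall>F\<in>{F}. \<not> contained_in F G"
    then show "degree_power_sum (real s) G \<le> K * real n ^ s"
      using n0[of G] that s degree_power_sum_of_nat[of s G] by simp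
  qed
  then show ?thesis unfolding K_def h_def by (rule eventually_sequentiallyI)
qed

section \<open>The three bounds\<close>

theorem theorem1p4:
  fixes F :: "'a graph" and s :: nat
  shows
   "(\<forall>l::nat. l \<ge> 3 \<longrightarrow>
       (\<forall>\<^sub>F n in sequentially.
          ex (real l / (real l - 1)) n {cycle_graph (2 * k) | k. 2 \<le> k \<and> k \<le> l}
            \<le> 765 * real n powr (real l / (real l - 1)))) \<and>
    (\<forall>\<^sub>F n in sequentially.
       ex (3 / 2) n {cycle_graph 6} \<le> 2164 * real n powr (3 / 2)) \<and>
    (s \<ge> 1 \<and> bounded_bipartite s F \<longrightarrow>
       (\<forall>\<^sub>F n in sequentially.
          ex (real s) n {F}
            \<le> 2 * (real (card (verts F)) ^ s / fact s + real (card (verts F))) * real n ^ s))"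
proof (intro conjI allI impI)
  show "\<forall>\<^sub>F n in sequentially.
      ex (real l / (real l - 1)) n {cycle_graph (2 * k) | k. 2 \<le> k \<and> k \<le> l}
        \<le> 765 * real n powr (real l / (real l - 1))" if "3 \<le> l" for l
    using ex_even_cycles_le[OF that] by (rule always_eventually[OF allI])
  show "\<forall>\<^sub>F n in sequentially. ex (3 / 2) n {cycle_graph 6} \<le> 2164 * real n powr (3 / 2)"
    using ex_C6_le by (rule always_eventually[OF allI])
qed (use ex_bounded_bipartite_le in blast)

end
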